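(* The Polish monoid $C(2^\omega,2^\omega)$ is universal for separable metrizable l-NA monoids: it is a separable metrizable l-NA topological monoid, and every separable metrizable l-NA topological monoid embeds, as a topological monoid, into it. Moreover, the action of $C(2^\omega,2^\omega)$ on $2^\omega$ is universal in the class of all actions $S\times Y\to Y$, where $Y$ is a metrizable Stone space and $S$ is a topological submonoid of $C(Y,Y)$; that is, for every such $S$ and $Y$ there exist an embedding of topological monoids $h:S\hookrightarrow C(2^\omega,2^\omega)$ and a topological embedding $\alpha:Y\hookrightarrow 2^\omega$ such that $\alpha(s(y))=h(s)(\alpha(y))$ for all $s\in S$, $y\in Y$.
   Context: All topological spaces are Tychonoff. A topological monoid is a monoid with a Tychonoff topology for which multiplication is jointly continuous. Monoid homomorphisms preserve the identity; an embedding of topological monoids is an injective homomorphism which is a homeomorphism onto its image. A Stone space is a compact Hausdorff space with a base of clopen sets. For compact $Y$, $C(Y,Y)$ is the monoid of continuous self-maps of $Y$ under composition with the compact-open topology. $2^\omega$ is the Cantor cube. A topological monoid $S$ is l-NA (left non-archimedean) if there are a Stone space $Z$, a jointly continuous left monoid action $S\times Z\to Z$ (with $e_S$ acting as the identity), and a topological embedding $\nu:S\hookrightarrow Z$ with dense image such that $\nu(st)=s\nu(t)$ for all $s,t\in S$. *)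

theory Defs
  imports "HOL-Algebra.Group" "HOL-Analysis.Analysis"
begin

no_notation eq_closure_of (\<open>closure'_of\<index>\<close>)

definition tychonoff_space :: "'a topology \<Rightarrow> bool" where
  "tychonoff_space X \<longleftrightarrow> completely_regular_space X \<and> Hausdorff_space X"

definition stone_space :: "'a topology \<Rightarrow> bool" where
  "stone_space X \<longleftrightarrow> compact_space X \<and> Hausdorff_space X \<and>
     (\<exists>\<B>. (\<forall>V\<in>\<B>. openin X V \<and> closedin X V) \<and>
          (\<forall>U x. openin X U \<and> x \<in> U \<longrightarrow> (\<exists>V\<in>\<B>. x \<in> V \<and> V \<subseteq> U)))"

definition polish_space :: "'a topology \<Rightarrow> bool" where
  "polish_space X \<longleftrightarrow> completely_metrizable_space X \<and> separable_space X"


definition topological_monoid :: "('a, 'm) monoid_scheme \<Rightarrow> 'a topology \<Rightarrow> bool" where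
  "topological_monoid M T \<longleftrightarrow>
     monoid M \<and> topspace T = carrier M \<and> tychonoff_space T \<and>
     continuous_map (prod_topology T T) T (\<lambda>(x, y). x \<otimes>\<^bsub>M\<^esub> y)"

definition topological_monoid_embedding ::
    "('a, 'm) monoid_scheme \<Rightarrow> 'a topology \<Rightarrow> ('b, 'n) monoid_scheme \<Rightarrow> 'b topology \<Rightarrow>
     ('a \<Rightarrow> 'b) \<Rightarrow> bool" where
  "topological_monoid_embedding M T N U h \<longleftrightarrow>
     h \<in> hom M N \<and> h \<one>\<^bsub>M\<^esub> = \<one>\<^bsub>N\<^esub> \<and> embedding_map T U h"


text \<open>A continuous self-map of \<open>Y\<close> is represented by the function that is \<open>undefined\<close> outside
  \<open>topspace Y\<close>, so that equality of elements is equality of maps on \<open>Y\<close>.\<close>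

definition cont_selfmaps :: "'a topology \<Rightarrow> ('a \<Rightarrow> 'a) set" where
  "cont_selfmaps Y = {f \<in> extensional (topspace Y). continuous_map Y Y f}"

definition selfmap_monoid :: "'a topology \<Rightarrow> ('a \<Rightarrow> 'a) monoid" where
  "selfmap_monoid Y =
     \<lparr>carrier = cont_selfmaps Y, monoid.mult = compose (topspace Y), one = (\<lambda>x\<in>topspace Y. x)\<rparr>"

text \<open>The choice \<open>K = {}\<close> shows that the underlying set is all of \<open>cont_selfmaps Y\<close>.\<close>

definition compact_open_topology :: "'a topology \<Rightarrow> ('a \<Rightarrow> 'a) topology" where
  "compact_open_topology Y =
     topology_generated_by {{f \<in> cont_selfmaps Y. f ` K \<subseteq> U} | K U. compactin Y K \<and> openin Y U}"

definition cantor_cube :: "(nat \<Rightarrow> bool) topology" where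
  "cantor_cube = product_topology (\<lambda>_. discrete_topology UNIV) UNIV"


definition l_NA_witness ::
    "('a, 'm) monoid_scheme \<Rightarrow> 'a topology \<Rightarrow> 'z topology \<Rightarrow> ('a \<Rightarrow> 'z \<Rightarrow> 'z) \<Rightarrow> ('a \<Rightarrow> 'z) \<Rightarrow> bool" where
  "l_NA_witness M T Z act \<nu> \<longleftrightarrow>
     stone_space Z \<and>
     continuous_map (prod_topology T Z) Z (\<lambda>(s, z). act s z) \<and>
     (\<forall>z\<in>topspace Z. act \<one>\<^bsub>M\<^esub> z = z) \<and>
     (\<forall>s\<in>carrier M. \<forall>t\<in>carrier M. \<forall>z\<in>topspace Z. act (s \<otimes>\<^bsub>M\<^esub> t) z = act s (act t z)) \<and>
     embedding_map T Z \<nu> \<and>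
     Z closure_of (\<nu> ` topspace T) = topspace Z \<and>
     (\<forall>s\<in>carrier M. \<forall>t\<in>carrier M. \<nu> (s \<otimes>\<^bsub>M\<^esub> t) = act s (\<nu> t))"

text \<open>A definition cannot quantify over the type that carries the Stone space. The type
  \<^typ>\<open>'a set set\<close> is large enough: a Hausdorff space with a dense image of the monoid has at
  most \<open>2^2^|M|\<close> points. The lemma \<open>l_NA_of_witness\<close> below shows that a witness
  over any type will do.\<close>

definition l_NA :: "('a, 'm) monoid_scheme \<Rightarrow> 'a topology \<Rightarrow> bool" where
  "l_NA M T \<longleftrightarrow> topological_monoid M T \<and>
     (\<exists>(Z :: 'a set set topology) act \<nu>. l_NA_witness M T Z act \<nu>)"

lemma Hausdorff_dense_inj:
  fixes Z :: "'z topology" and \<nu> :: "'a \<Rightarrow> 'z"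
  assumes H: "Hausdorff_space Z" and D: "Z closure_of (\<nu> ` S) = topspace Z"
  shows "\<exists>g :: 'z \<Rightarrow> 'a set set. inj_on g (topspace Z)"
proof -
  define g :: "'z \<Rightarrow> 'a set set" where "g z = {A. A \<subseteq> S \<and> z \<in> Z closure_of (\<nu> ` A)}" for z
  have "inj_on g (topspace Z)"
  proof (rule inj_onI, rule ccontr)
    fix x y assume x: "x \<in> topspace Z" and y: "y \<in> topspace Z" and e: "g x = g y" and n: "x \<noteq> y"
    obtain U V where UV: "openin Z U" "openin Z V" "x \<in> U" "y \<in> V" "disjnt U V"
      using H x y n unfolding Hausdorff_space_def by blast
    define A where "A = {s \<in> S. \<nu> s \<in> U}"
    have "x \<in> Z closure_of (\<nu> ` A)"
      unfolding in_closure_of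
    proof (intro conjI allI impI)
      show "x \<in> topspace Z" by (rule x)
      fix W assume W: "x \<in> W \<and> openin Z W"
      then have "openin Z (U \<inter> W)" "x \<in> U \<inter> W" using UV by auto
      moreover have "x \<in> Z closure_of (\<nu> ` S)" using D x by simp
      ultimately obtain q where "q \<in> \<nu> ` S" "q \<in> U \<inter> W" unfolding in_closure_of by blast
      then show "\<exists>y. y \<in> \<nu> ` A \<and> y \<in> W" unfolding A_def by blast
    qed
    then have "A \<in> g x" by (auto simp: g_def A_def)
    then have "y \<in> Z closure_of (\<nu> ` A)" using e by (auto simp: g_def)
    then obtain q where "q \<in> \<nu> ` A" "q \<in> V" using UV unfolding in_closure_of by blast
    then show False using UV by (auto simp: A_def disjnt_def)
  qed
  then show ?thesis by blast
qed

lemma stone_space_homeomorphic: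
  assumes h: "homeomorphic_maps Z W f g" and s: "stone_space Z"
  shows "stone_space W"
proof -
  have hs: "Z homeomorphic_space W" using h by (auto simp: homeomorphic_space_def)
  have hf: "homeomorphic_map Z W f" using h by (meson homeomorphic_maps_map)
  have cf: "continuous_map Z W f"
    using h by (auto simp: homeomorphic_maps_def)
  have gm: "g y \<in> topspace Z" "f (g y) = y" if "y \<in> topspace W" for y
    using h that by (auto simp: homeomorphic_maps_def continuous_map_def)
  obtain \<B> where B: "\<And>V. V \<in> \<B> \<Longrightarrow> openin Z V \<and> closedin Z V"
    and base: "\<And>U x. openin Z U \<Longrightarrow> x \<in> U \<Longrightarrow> \<exists>V\<in>\<B>. x \<in> V \<and> V \<subseteq> U"
    using s unfolding stone_space_def by metis
  have "\<exists>\<C>. (\<forall>V\<in>\<C>. openin W V \<and> closedin W V) \<and>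
          (\<forall>U x. openin W U \<and> x \<in> U \<longrightarrow> (\<exists>V\<in>\<C>. x \<in> V \<and> V \<subseteq> U))"
  proof (rule exI[of _ "(\<lambda>V. f ` V) ` \<B>"], intro conjI ballI allI impI)
    fix V assume "V \<in> (\<lambda>V. f ` V) ` \<B>"
    then obtain V' where V': "V' \<in> \<B>" "V = f ` V'" by blast
    show "openin W V" "closedin W V"
      using B[OF V'(1)] hf V'(2)
      by (meson homeomorphic_map_openness_eq homeomorphic_map_closedness_eq)+
  next
    fix U y assume U: "openin W U \<and> y \<in> U"
    then have y: "y \<in> topspace W" using openin_subset by blast
    have "openin Z {x \<in> topspace Z. f x \<in> U}"
      using cf U by (simp add: continuous_map_def)
    from base[OF this, of "g y"] obtain V where V: "V \<in> \<B>" "g y \<in> V" "V \<subseteq> {x \<in> topspace Z. f x \<in> U}"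
      using gm[OF y] U by auto
    then have "y \<in> f ` V" "f ` V \<subseteq> U" using gm[OF y] by (metis imageI, blast)
    then show "\<exists>V\<in>(\<lambda>V. f ` V) ` \<B>. y \<in> V \<and> V \<subseteq> U" using V by blast
  qed
  moreover have "compact_space W" "Hausdorff_space W"
    using s homeomorphic_compact_space[OF hs] homeomorphic_Hausdorff_space[OF hs]
    by (simp_all add: stone_space_def)
  ultimately show ?thesis
    unfolding stone_space_def by (intro conjI)
qed

lemma l_NA_witness_transport:
  assumes h: "homeomorphic_maps Z W f g" and w: "l_NA_witness M T Z act \<nu>"
    and T: "topspace T = carrier M"
  shows "l_NA_witness M T W (\<lambda>s y. f (act s (g y))) (f \<circ> \<nu>)"
proof -
  have cf: "continuous_map Z W f" and cg: "continuous_map W Z g"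
    using h by (auto simp: homeomorphic_maps_def)
  have hf: "homeomorphic_map Z W f" using h by (meson homeomorphic_maps_map)
  have gf: "g (f z) = z" if "z \<in> topspace Z" for z using h that by (auto simp: homeomorphic_maps_def)
  have fg: "f (g y) = y" "g y \<in> topspace Z" if "y \<in> topspace W" for y
    using h that by (auto simp: homeomorphic_maps_def continuous_map_def)
  have ca: "continuous_map (prod_topology T Z) Z (\<lambda>(s, z). act s z)"
    and em: "embedding_map T Z \<nu>"
    and dense: "Z closure_of (\<nu> ` topspace T) = topspace Z"
    using w by (auto simp: l_NA_witness_def)
  have am: "act s z \<in> topspace Z" if "s \<in> carrier M" "z \<in> topspace Z" for s z
  proof -
    have "(s, z) \<in> topspace (prod_topology T Z)" using that T by simp
    from funcset_mem[OF continuous_map_funspace[OF ca] this] show ?thesis by simp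
  qed
  have c\<nu>: "continuous_map T Z \<nu>"
    using em homeomorphic_imp_continuous_map continuous_map_in_subtopology
    unfolding embedding_map_def by blast
  have \<nu>m: "\<nu> s \<in> topspace Z" if "s \<in> carrier M" for s
    using funcset_mem[OF continuous_map_funspace[OF c\<nu>]] that T
    by simp
  have pair: "continuous_map (prod_topology T W) (prod_topology T Z) (\<lambda>(s, y). (s, g y))"
    using cg by (simp add: continuous_map_prod_top)
  have 1: "continuous_map (prod_topology T W) W (\<lambda>(s, y). f (act s (g y)))"
    using continuous_map_compose[OF pair continuous_map_compose[OF ca cf]]
    by (simp add: o_def case_prod_unfold)
  have 2: "embedding_map T W (f \<circ> \<nu>)"
    using embedding_map_compose[OF em] hf surjective_embedding_map by blast
  have "W closure_of (f ` (\<nu> ` topspace T)) = f ` (Z closure_of (\<nu> ` topspace T))"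
    using hf \<nu>m T by (intro homeomorphic_map_closure_of) auto
  then have 3: "W closure_of ((f \<circ> \<nu>) ` topspace T) = topspace W"
    using dense hf by (simp add: image_comp homeomorphic_imp_surjective_map)
  have stone: "stone_space W" using stone_space_homeomorphic[OF h] w by (simp add: l_NA_witness_def)
  have one: "act \<one>\<^bsub>M\<^esub> z = z" if "z \<in> topspace Z" for z
    using w that by (simp add: l_NA_witness_def)
  have mult: "act (s \<otimes>\<^bsub>M\<^esub> t) z = act s (act t z)"
    if "s \<in> carrier M" "t \<in> carrier M" "z \<in> topspace Z" for s t z
    using w that unfolding l_NA_witness_def by blast
  have equiv: "\<nu> (s \<otimes>\<^bsub>M\<^esub> t) = act s (\<nu> t)" if "s \<in> carrier M" "t \<in> carrier M" for s t
    using w that unfolding l_NA_witness_def by blast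
  show ?thesis
    unfolding l_NA_witness_def
    by (intro conjI ballI stone 1 2 3) (simp_all add: one mult equiv gf fg am \<nu>m)
qed

lemma l_NA_of_witness:
  fixes Z :: "'z topology"
  assumes "topological_monoid M T" and w: "l_NA_witness M T Z act \<nu>"
  shows "l_NA M T"
proof -
  obtain g :: "_ \<Rightarrow> 'a set set" where g: "inj_on g (topspace Z)"
    using Hausdorff_dense_inj w unfolding l_NA_witness_def stone_space_def by metis
  define k where "k = inv_into (topspace Z) g"
  define W where "W = pullback_topology (g ` topspace Z) k Z"
  have kg: "k (g z) = z" if "z \<in> topspace Z" for z using g that by (simp add: k_def)
  have tW: "topspace W = g ` topspace Z"
    using kg by (auto simp: W_def topspace_pullback_topology)
  have "continuous_map Z W g"
    unfolding continuous_map_def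
  proof (intro conjI allI impI)
    show "g \<in> topspace Z \<rightarrow> topspace W" by (auto simp: tW)
    fix U assume "openin W U"
    then obtain V where V: "openin Z V" "U = k -` V \<inter> g ` topspace Z"
      by (auto simp: W_def openin_pullback_topology)
    then have "{z \<in> topspace Z. g z \<in> U} = V"
      using openin_subset[OF V(1)] by (auto simp: kg)
    then show "openin Z {z \<in> topspace Z. g z \<in> U}" using V by simp
  qed
  moreover have "continuous_map W Z k"
    unfolding continuous_map_def
  proof (intro conjI allI impI)
    show "k \<in> topspace W \<rightarrow> topspace Z" by (auto simp: tW kg)
    fix U assume "openin Z U"
    moreover have "{y \<in> topspace W. k y \<in> U} = k -` U \<inter> g ` topspace Z" by (auto simp: tW)
    ultimately show "openin W {y \<in> topspace W. k y \<in> U}"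
      unfolding W_def openin_pullback_topology by blast
  qed
  ultimately have "homeomorphic_maps Z W g k"
    by (auto simp: homeomorphic_maps_def kg tW)
  from l_NA_witness_transport[OF this w] assms(1) show ?thesis
    unfolding l_NA_def topological_monoid_def by blast
qed

end

theory Submission
  imports Defs
begin

text \<open>For a Stone space \<open>Y\<close>, the compact-open topology on \<open>C(Y,Y)\<close> is the topology of pointwise
  convergence of \<open>s \<mapsto> (B \<mapsto> s\<^sup>-\<^sup>1 B)\<close> on the discrete set of clopen sets. If \<open>Y\<close> is metrizable, there
  are countably many clopen sets, so every submonoid of \<open>C(Y,Y)\<close> embeds into \<open>\<nat>\<^sup>\<nat>\<close> with reversed
  composition. The same holds for a separable metrizable l-NA monoid with witness \<open>Z\<close>: choose
  countably many clopen subsets of \<open>Z\<close> whose traces form a base of the monoid. Each of them has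
  only countably many preimages under the action, because by compactness of \<open>Z\<close> the preimage is a
  locally constant function of the acting element. These preimages form a countable
  invariant family that determines the topology of the monoid.

  Conversely, \<open>\<nat>\<^sup>\<nat>\<close> with reversed composition acts on \<open>2\<^sup>\<omega>\<close> by reindexing, \<open>x \<mapsto> x \<circ> \<rho>\<close>, which
  embeds it into \<open>C(2\<^sup>\<omega>,2\<^sup>\<omega>)\<close>. The map sending \<open>y\<close> to the characteristic function of the clopen
  sets that contain it is equivariant. In this way the identity is preserved, which an extension along a
  retraction of \<open>2\<^sup>\<omega>\<close> onto a copy of \<open>Y\<close> would not achieve.\<close>

section \<open>Powers of discrete spaces\<close>

abbreviation discrete_power :: "('i \<Rightarrow> 'b) topology" where
  "discrete_power \<equiv> product_topology (\<lambda>_. discrete_topology UNIV) UNIV"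

text \<open>Local constancy is the form in which compactness and density arguments deliver
  continuity into a discrete space, so the later sections use this criterion instead of
  preimages.\<close>

lemma continuous_map_discrete_iff:
  "continuous_map X (discrete_topology UNIV) g \<longleftrightarrow>
     (\<forall>x\<in>topspace X. \<exists>U. openin X U \<and> x \<in> U \<and> (\<forall>y\<in>U. g y = g x))"
proof
  assume g: "continuous_map X (discrete_topology UNIV) g"
  show "\<forall>x\<in>topspace X. \<exists>U. openin X U \<and> x \<in> U \<and> (\<forall>y\<in>U. g y = g x)"
  proof
    fix x assume "x \<in> topspace X"
    moreover have "openin X {y \<in> topspace X. g y \<in> {g x}}"
      using g by (rule openin_continuous_map_preimage) simp
    ultimately show "\<exists>U. openin X U \<and> x \<in> U \<and> (\<forall>y\<in>U. g y = g x)" by fastforce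
  qed
next
  assume loc: "\<forall>x\<in>topspace X. \<exists>U. openin X U \<and> x \<in> U \<and> (\<forall>y\<in>U. g y = g x)"
  have "openin X {x \<in> topspace X. g x \<in> V}" for V
    unfolding openin_subopen[of X "{x \<in> topspace X. g x \<in> V}"]
  proof
    fix x assume x: "x \<in> {x \<in> topspace X. g x \<in> V}"
    then obtain U where "openin X U" "x \<in> U" "\<forall>y\<in>U. g y = g x" using loc by blast
    then show "\<exists>T. openin X T \<and> x \<in> T \<and> T \<subseteq> {x \<in> topspace X. g x \<in> V}"
      using x openin_subset by (intro exI[of _ U]) fastforce
  qed
  then show "continuous_map X (discrete_topology UNIV) g" by (simp add: continuous_map_def)
qed

lemma openin_discrete_power_nhd:
  assumes "openin (discrete_power :: ('i \<Rightarrow> 'b) topology) V" "a \<in> V"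
  shows "\<exists>F. finite F \<and> (\<forall>b. (\<forall>i\<in>F. b i = a i) \<longrightarrow> b \<in> V)"
proof -
  obtain U where U: "finite {i. U i \<noteq> topspace (discrete_topology (UNIV :: 'b set))}"
      "a \<in> Pi\<^sub>E UNIV U" "Pi\<^sub>E UNIV U \<subseteq> V"
    using assms unfolding openin_product_topology_alt by fastforce
  have "b \<in> V" if "\<forall>i\<in>{i. U i \<noteq> UNIV}. b i = a i" for b
  proof -
    have "b i \<in> U i" for i using that U(2) by (cases "U i = UNIV") (auto simp: PiE_iff)
    then show ?thesis using U(3) by auto
  qed
  then show ?thesis using U(1) by auto
qed

lemma openin_discrete_power_cylinder:
  assumes "finite F"
  shows "openin (discrete_power :: ('i \<Rightarrow> 'b) topology) {b. \<forall>i\<in>F. b i \<in> W i}"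
proof -
  have o: "openin discrete_power (Pi\<^sub>E UNIV (\<lambda>i. if i \<in> F then W i else UNIV))"
  proof (subst openin_PiE_gen, intro disjI2 conjI ballI)
    show "finite {i \<in> UNIV. (if i \<in> F then W i else UNIV) \<noteq> topspace (discrete_topology UNIV)}"
      by (rule finite_subset[OF _ assms]) auto
  qed simp
  moreover have "Pi\<^sub>E UNIV (\<lambda>i. if i \<in> F then W i else UNIV) = {b. \<forall>i\<in>F. b i \<in> W i}"
  proof (rule Set.set_eqI)
    fix b show "b \<in> Pi\<^sub>E UNIV (\<lambda>i. if i \<in> F then W i else UNIV) \<longleftrightarrow> b \<in> {b. \<forall>i\<in>F. b i \<in> W i}"
      by (auto simp: PiE_iff)
  qed
  ultimately show ?thesis by simp
qed

section \<open>Topological embeddings and their coordinates in discrete powers\<close>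

lemma embedding_mapI:
  assumes c: "continuous_map X Y f" and i: "inj_on f (topspace X)"
    and o: "\<And>U. openin X U \<Longrightarrow> \<exists>V. openin Y V \<and> U = {x \<in> topspace X. f x \<in> V}"
  shows "embedding_map X Y f"
proof -
  have "homeomorphic_map X (subtopology Y (f ` topspace X)) f"
  proof (rule bijective_open_imp_homeomorphic_map)
    show "continuous_map X (subtopology Y (f ` topspace X)) f"
      using c by (simp add: continuous_map_in_subtopology)
    show "open_map X (subtopology Y (f ` topspace X)) f"
      unfolding open_map_def
    proof (intro allI impI)
      fix U assume "openin X U"
      then obtain V where V: "openin Y V" "U = {x \<in> topspace X. f x \<in> V}" using o by blast
      have "f ` U = V \<inter> f ` topspace X" unfolding V(2) by blast
      then show "openin (subtopology Y (f ` topspace X)) (f ` U)"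
        using V(1) unfolding openin_subtopology by blast
    qed
    show "f ` topspace X = topspace (subtopology Y (f ` topspace X))"
      using continuous_map_image_subset_topspace[OF c] by auto
  qed (rule i)
  then show ?thesis by (simp add: embedding_map_def)
qed

lemma embedding_map_imp_continuous_map: "embedding_map X Y f \<Longrightarrow> continuous_map X Y f"
  unfolding embedding_map_def
  using homeomorphic_imp_continuous_map continuous_map_into_fulltopology by metis

lemma embedding_map_imp_inj_on: "embedding_map X Y f \<Longrightarrow> inj_on f (topspace X)"
  unfolding embedding_map_def by (rule homeomorphic_imp_injective_map)

lemma embedding_map_openin_preimage:
  assumes e: "embedding_map X Y f" and U: "openin X U"
  obtains V where "openin Y V" "U = {x \<in> topspace X. f x \<in> V}"
proof -
  have "openin (subtopology Y (f ` topspace X)) (f ` U)"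
    using e homeomorphic_map_openness_eq U unfolding embedding_map_def by blast
  then obtain V where V: "openin Y V" "f ` U = V \<inter> f ` topspace X"
    unfolding openin_subtopology by blast
  have "U = {x \<in> topspace X. f x \<in> V}"
  proof (rule Set.set_eqI)
    fix x show "x \<in> U \<longleftrightarrow> x \<in> {x \<in> topspace X. f x \<in> V}"
      using openin_subset[OF U] V(2)
        inj_on_image_mem_iff[OF embedding_map_imp_inj_on[OF e], of x U] by blast
  qed
  then show thesis using V(1) that by blast
qed

text \<open>An embedded space carries the initial topology of the embedding, so continuity into it
  can be tested after composing with \<open>g\<close>. This lets continuity of the multiplication be
  checked coordinatewise.\<close>

lemma continuous_map_cancel_embedding_map:
  assumes g: "embedding_map Y Z g" and gf: "continuous_map X Z (g \<circ> f)"
    and f: "f ` topspace X \<subseteq> topspace Y"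
  shows "continuous_map X Y f"
  unfolding continuous_map_def
proof (intro conjI allI impI)
  show "f \<in> topspace X \<rightarrow> topspace Y" using f by blast
  fix V assume "openin Y V"
  then obtain W where W: "openin Z W" "V = {y \<in> topspace Y. g y \<in> W}"
    by (rule embedding_map_openin_preimage[OF g])
  have "{x \<in> topspace X. f x \<in> V} = {x \<in> topspace X. (g \<circ> f) x \<in> W}"
    unfolding W(2) using f by auto
  then show "openin X {x \<in> topspace X. f x \<in> V}"
    using openin_continuous_map_preimage[OF gf W(1)] by simp
qed

lemma embedding_map_cancel_left:
  assumes g: "embedding_map Y Z g" and gf: "embedding_map X Z (g \<circ> f)"
    and f: "f ` topspace X \<subseteq> topspace Y"
  shows "embedding_map X Y f"
proof (rule embedding_mapI)
  show "inj_on f (topspace X)"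
    using embedding_map_imp_inj_on[OF gf] by (rule inj_on_imageI2)
  show "continuous_map X Y f"
    using g embedding_map_imp_continuous_map[OF gf] f by (rule continuous_map_cancel_embedding_map)
  fix U assume "openin X U"
  then obtain W where W: "openin Z W" "U = {x \<in> topspace X. (g \<circ> f) x \<in> W}"
    by (rule embedding_map_openin_preimage[OF gf])
  have "U = {x \<in> topspace X. f x \<in> {y \<in> topspace Y. g y \<in> W}}"
    unfolding W(2) using f by auto
  then show "\<exists>V. openin Y V \<and> U = {x \<in> topspace X. f x \<in> V}"
    using openin_continuous_map_preimage[OF embedding_map_imp_continuous_map[OF g] W(1)] by blast
qed

text \<open>Agreement with \<open>f x\<close> on finitely many indices defines a basic neighbourhood
  of \<open>f x\<close>, so the last hypothesis says that the trace of some cylinder around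
  \<open>f x\<close> lies inside \<open>U\<close>. Injectivity stands on its own because no
  separation axiom is imposed on \<open>X\<close>.\<close>

lemma embedding_map_into_discrete_powerI:
  fixes f :: "'a \<Rightarrow> 'i \<Rightarrow> 'b"
  assumes i: "inj_on f (topspace X)"
    and c: "\<And>i. continuous_map X (discrete_topology UNIV) (\<lambda>x. f x i)"
    and n: "\<And>U x. openin X U \<Longrightarrow> x \<in> U \<Longrightarrow>
        \<exists>F. finite F \<and> (\<forall>y\<in>topspace X. (\<forall>i\<in>F. f y i = f x i) \<longrightarrow> y \<in> U)"
  shows "embedding_map X discrete_power f"
proof (rule embedding_mapI)
  show "continuous_map X discrete_power f"
    using c by (simp add: continuous_map_componentwise_UNIV)
  fix U assume U: "openin X U"
  have "\<exists>V. openin discrete_power V \<and> f x \<in> V \<and> (\<forall>y\<in>topspace X. f y \<in> V \<longrightarrow> y \<in> U)"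
    if x: "x \<in> U" for x
  proof -
    obtain F where F: "finite F" "\<forall>y\<in>topspace X. (\<forall>i\<in>F. f y i = f x i) \<longrightarrow> y \<in> U"
      using n[OF U x] by blast
    show ?thesis
      using openin_discrete_power_cylinder[OF F(1), of "\<lambda>i. {f x i}"] F(2)
      by (intro exI[of _ "{b. \<forall>i\<in>F. b i \<in> {f x i}}"]) auto
  qed
  then obtain V where V: "\<And>x. x \<in> U \<Longrightarrow> openin discrete_power (V x)" "\<And>x. x \<in> U \<Longrightarrow> f x \<in> V x"
      "\<And>x y. x \<in> U \<Longrightarrow> y \<in> topspace X \<Longrightarrow> f y \<in> V x \<Longrightarrow> y \<in> U"
    by metis
  then have "openin discrete_power (\<Union>(V ` U))" by blast
  moreover have "U = {x \<in> topspace X. f x \<in> \<Union>(V ` U)}"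
    using V(2,3) openin_subset[OF U] by blast
  ultimately show "\<exists>V. openin discrete_power V \<and> U = {x \<in> topspace X. f x \<in> V}" by blast
qed (rule i)

lemma embedding_map_into_discrete_powerD:
  fixes f :: "'a \<Rightarrow> 'i \<Rightarrow> 'b"
  assumes e: "embedding_map X discrete_power f"
  shows "continuous_map X (discrete_topology UNIV) (\<lambda>x. f x i)"
    and "openin X U \<Longrightarrow> x \<in> U \<Longrightarrow>
        \<exists>F. finite F \<and> (\<forall>y\<in>topspace X. (\<forall>i\<in>F. f y i = f x i) \<longrightarrow> y \<in> U)"
proof -
  show "continuous_map X (discrete_topology UNIV) (\<lambda>x. f x i)"
    using embedding_map_imp_continuous_map[OF e] unfolding continuous_map_componentwise_UNIV by blast
  assume U: "openin X U" "x \<in> U"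
  obtain V where V: "openin discrete_power V" "U = {x \<in> topspace X. f x \<in> V}"
    using embedding_map_openin_preimage[OF e U(1)] .
  have "f x \<in> V" using U(2) V(2) by blast
  then obtain F where F: "finite F" "\<And>b. \<forall>i\<in>F. b i = f x i \<Longrightarrow> b \<in> V"
    using openin_discrete_power_nhd[OF V(1)] by blast
  then show "\<exists>F. finite F \<and> (\<forall>y\<in>topspace X. (\<forall>i\<in>F. f y i = f x i) \<longrightarrow> y \<in> U)"
    unfolding V(2) by blast
qed

section \<open>Stone spaces: Boolean powers and closed subspaces\<close>

lemma stone_space_discrete_power_bool: "stone_space (discrete_power :: ('i \<Rightarrow> bool) topology)"
proof -
  let ?B = "{V. openin (discrete_power :: ('i \<Rightarrow> bool) topology) V \<and> closedin discrete_power V}"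
  have cyl: "{b. \<forall>i\<in>F. b i = a i} \<in> ?B" if "finite F" for F :: "'i set" and a
  proof -
    \<comment> \<open>With only two values, differing from \<open>a i\<close> means taking the value
      \<open>\<not> a i\<close>, so the complement of a cylinder is a union of cylinders on one
      coordinate.\<close>
    have "openin discrete_power {b. \<exists>i\<in>F. b i \<noteq> a i}"
    proof -
      have "{b. \<exists>i\<in>F. b i \<noteq> a i} = (\<Union>i\<in>F. {b. \<forall>j\<in>{i}. b j \<in> {\<not> a i}})" by auto
      then show ?thesis
        using openin_discrete_power_cylinder[of "{i}" "\<lambda>j. {\<not> a i}" for i] by auto
    qed
    moreover have "topspace discrete_power - {b. \<forall>i\<in>F. b i = a i} = {b. \<exists>i\<in>F. b i \<noteq> a i}" by auto
    ultimately show ?thesis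
      using openin_discrete_power_cylinder[OF that, of "\<lambda>i. {a i}"] by (simp add: closedin_def)
  qed
  have "\<exists>V\<in>?B. x \<in> V \<and> V \<subseteq> U"
    if "openin discrete_power U" "x \<in> U" for U and x :: "'i \<Rightarrow> bool"
  proof -
    obtain F where "finite F" "\<forall>b. (\<forall>i\<in>F. b i = x i) \<longrightarrow> b \<in> U"
      using openin_discrete_power_nhd[OF \<open>openin discrete_power U\<close> \<open>x \<in> U\<close>] by blast
    then show ?thesis using cyl[of F x] by (intro bexI[of _ "{b. \<forall>i\<in>F. b i = x i}"]) auto
  qed
  then have "\<exists>\<B>. (\<forall>V\<in>\<B>. openin (discrete_power :: ('i \<Rightarrow> bool) topology) V \<and> closedin discrete_power V) \<and>
          (\<forall>U x. openin discrete_power U \<and> x \<in> U \<longrightarrow> (\<exists>V\<in>\<B>. x \<in> V \<and> V \<subseteq> U))"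
    by (intro exI[of _ ?B]) blast
  moreover have "compact_space (discrete_power :: ('i \<Rightarrow> bool) topology)"
    by (simp add: compact_space_product_topology compact_space_discrete_topology)
  moreover have "Hausdorff_space (discrete_power :: ('i \<Rightarrow> bool) topology)"
    by (simp add: Hausdorff_space_product_topology)
  ultimately show ?thesis unfolding stone_space_def by (intro conjI)
qed

lemma stone_space_closed_subspace:
  assumes Z: "stone_space Z" and C: "closedin Z C"
  shows "stone_space (subtopology Z C)"
proof -
  obtain \<B> where B: "\<forall>V\<in>\<B>. openin Z V \<and> closedin Z V"
      "\<forall>U x. openin Z U \<and> x \<in> U \<longrightarrow> (\<exists>V\<in>\<B>. x \<in> V \<and> V \<subseteq> U)"
    using Z unfolding stone_space_def by blast
  have "\<exists>\<C>. (\<forall>V\<in>\<C>. openin (subtopology Z C) V \<and> closedin (subtopology Z C) V) \<and>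
          (\<forall>U x. openin (subtopology Z C) U \<and> x \<in> U \<longrightarrow> (\<exists>V\<in>\<C>. x \<in> V \<and> V \<subseteq> U))"
  proof (intro exI[of _ "(\<lambda>V. V \<inter> C) ` \<B>"] conjI ballI allI impI)
    fix V assume "V \<in> (\<lambda>V. V \<inter> C) ` \<B>"
    then obtain W where W: "W \<in> \<B>" "V = W \<inter> C" by blast
    show "openin (subtopology Z C) V" "closedin (subtopology Z C) V"
      using B(1)[rule_format, OF W(1)] unfolding openin_subtopology closedin_subtopology W(2) by blast+
  next
    fix U x assume U: "openin (subtopology Z C) U \<and> x \<in> U"
    obtain W where W: "openin Z W" "U = W \<inter> C"
      using conjunct1[OF U] unfolding openin_subtopology by blast
    then obtain V where "V \<in> \<B>" "x \<in> V" "V \<subseteq> W"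
      using B(2)[rule_format, of W x] U by blast
    then show "\<exists>V\<in>(\<lambda>V. V \<inter> C) ` \<B>. x \<in> V \<and> V \<subseteq> U"
      using W(2) U by (intro bexI[of _ "V \<inter> C"]) blast+
  qed
  moreover have "compact_space (subtopology Z C)"
    using Z C by (simp add: stone_space_def closedin_compact_space compact_space_subtopology)
  moreover have "Hausdorff_space (subtopology Z C)"
    using Z by (simp add: stone_space_def Hausdorff_space_subtopology)
  ultimately show ?thesis unfolding stone_space_def by (intro conjI)
qed

section \<open>Monoids acting on the natural numbers from the right\<close>

text \<open>Near a point \<open>p\<close> is constant, so only one member of the family
  \<open>g\<close> is evaluated there. This handles composition and reindexing, where the coordinate
  to be read itself depends on the point.\<close>

lemma continuous_map_discrete_dependent:
  assumes p: "continuous_map X (discrete_topology UNIV) p"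
    and g: "\<And>m. continuous_map X (discrete_topology UNIV) (g m)"
  shows "continuous_map X (discrete_topology UNIV) (\<lambda>x. g (p x) x)"
  unfolding continuous_map_discrete_iff
proof
  fix x assume x: "x \<in> topspace X"
  obtain U where U: "openin X U" "x \<in> U" "\<forall>y\<in>U. p y = p x"
    using p x unfolding continuous_map_discrete_iff by blast
  obtain V where V: "openin X V" "x \<in> V" "\<forall>y\<in>V. g (p x) y = g (p x) x"
    using g[of "p x"] x unfolding continuous_map_discrete_iff by blast
  show "\<exists>U. openin X U \<and> x \<in> U \<and> (\<forall>y\<in>U. g (p y) y = g (p x) x)"
  proof (intro exI[of _ "U \<inter> V"] conjI ballI)
    fix y assume "y \<in> U \<inter> V"
    then have "p y = p x" "g (p x) y = g (p x) x" using U(3) V(3) by blast+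
    then show "g (p y) y = g (p x) x" by simp
  qed (use U V in blast)+
qed

lemma continuous_map_discrete_comp:
  "continuous_map X (discrete_topology UNIV) p \<Longrightarrow>
    continuous_map X (discrete_topology UNIV) (\<lambda>x. k (p x))"
  using continuous_map_discrete_dependent[of X p "\<lambda>m _. k m"]
  unfolding continuous_map_discrete_iff by blast

text \<open>The reversed order is that of preimages: \<open>(s \<circ> t)\<^sup>-\<^sup>1 =
  t\<^sup>-\<^sup>1 \<circ> s\<^sup>-\<^sup>1\<close>. Reindexing sequences by \<open>\<rho>\<close>
  reverses the order once more and so gives a left action.\<close>

definition right_nat_action ::
    "('a, 'm) monoid_scheme \<Rightarrow> 'a topology \<Rightarrow> ('a \<Rightarrow> nat \<Rightarrow> nat) \<Rightarrow> bool" where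
  "right_nat_action M T \<rho> \<longleftrightarrow>
     \<rho> \<one>\<^bsub>M\<^esub> = id \<and>
     (\<forall>s\<in>carrier M. \<forall>t\<in>carrier M. \<rho> (s \<otimes>\<^bsub>M\<^esub> t) = \<rho> t \<circ> \<rho> s) \<and>
     embedding_map T discrete_power \<rho>"

lemma right_nat_action_imp_metrizable_space:
  assumes "right_nat_action M T \<rho>"
  shows "metrizable_space T"
proof -
  have "metrizable_space (discrete_power :: (nat \<Rightarrow> nat) topology)"
    by (simp add: metrizable_space_product_topology)
  then have "metrizable_space (subtopology discrete_power (\<rho> ` topspace T))"
    by (rule metrizable_space_subtopology)
  moreover have "T homeomorphic_space subtopology discrete_power (\<rho> ` topspace T)"
    using assms unfolding right_nat_action_def by (blast intro: embedding_map_imp_homeomorphic_space)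
  ultimately show ?thesis using homeomorphic_metrizable_space by blast
qed

lemma right_nat_action_imp_topological_monoid:
  assumes M: "monoid M" and T: "topspace T = carrier M" and r: "right_nat_action M T \<rho>"
  shows "topological_monoid M T"
proof -
  have e: "embedding_map T discrete_power \<rho>" using r by (simp add: right_nat_action_def)
  have c: "continuous_map T (discrete_topology UNIV) (\<lambda>s. \<rho> s n)" for n
    using e by (rule embedding_map_into_discrete_powerD)
  have "continuous_map (prod_topology T T) T (\<lambda>(x, y). x \<otimes>\<^bsub>M\<^esub> y)"
  proof (rule continuous_map_cancel_embedding_map[OF e])
    \<comment> \<open>Coordinate \<open>n\<close> of the product of two elements is found by looking
      up, in the second factor, the index that the first factor assigns to \<open>n\<close>.\<close>
    have "continuous_map (prod_topology T T) (discrete_topology UNIV) (\<lambda>p. \<rho> (snd p) (\<rho> (fst p) n))" for n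
    proof (rule continuous_map_discrete_dependent[where g = "\<lambda>m p. \<rho> (snd p) m"])
      show "continuous_map (prod_topology T T) (discrete_topology UNIV) (\<lambda>p. \<rho> (fst p) n)"
        using continuous_map_compose[OF continuous_map_fst c] by (simp add: o_def)
      show "continuous_map (prod_topology T T) (discrete_topology UNIV) (\<lambda>p. \<rho> (snd p) m)" for m
        using continuous_map_compose[OF continuous_map_snd c] by (simp add: o_def)
    qed
    then have "continuous_map (prod_topology T T) discrete_power (\<lambda>p n. \<rho> (snd p) (\<rho> (fst p) n))"
      by (simp add: continuous_map_componentwise_UNIV)
    then show "continuous_map (prod_topology T T) discrete_power (\<rho> \<circ> (\<lambda>(x, y). x \<otimes>\<^bsub>M\<^esub> y))"
      using r T by (elim continuous_map_eq) (auto simp: right_nat_action_def)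
    show "(\<lambda>(x, y). x \<otimes>\<^bsub>M\<^esub> y) ` topspace (prod_topology T T) \<subseteq> topspace T"
      using T monoid.m_closed[OF M] by auto
  qed
  moreover have "tychonoff_space T"
    using right_nat_action_imp_metrizable_space[OF r]
    by (simp add: tychonoff_space_def metrizable_imp_completely_regular_space metrizable_imp_Hausdorff_space)
  ultimately show ?thesis using M T by (simp add: topological_monoid_def)
qed

text \<open>The monoid acts on the Cantor set of relations between \<open>\<nat>\<close> and \<open>\<nat>\<close> by reindexing the second
  argument. The orbit of the equality relation consists of the graphs of the maps \<open>\<rho> s\<close>.\<close>

lemma right_nat_action_imp_l_NA:
  assumes M: "monoid M" and T: "topspace T = carrier M" and r: "right_nat_action M T \<rho>"
  shows "l_NA M T"
proof -
  define P where "P = (discrete_power :: (nat \<times> nat \<Rightarrow> bool) topology)"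
  define act where "act s \<phi> = (\<lambda>(a, b). \<phi> (a, \<rho> s b))" for s and \<phi> :: "nat \<times> nat \<Rightarrow> bool"
  define \<nu> where "\<nu> s = (\<lambda>(a, b). a = \<rho> s b)" for s
  \<comment> \<open>The orbit need not be dense in \<open>P\<close>, so its closure serves as the
    Stone space of the witness.\<close>
  define C where "C = P closure_of (\<nu> ` topspace T)"
  have tP: "topspace P = UNIV" by (simp add: P_def)
  have one: "\<rho> \<one>\<^bsub>M\<^esub> = id"
    and mult: "\<And>s t. s \<in> carrier M \<Longrightarrow> t \<in> carrier M \<Longrightarrow> \<rho> (s \<otimes>\<^bsub>M\<^esub> t) = \<rho> t \<circ> \<rho> s"
    and e: "embedding_map T discrete_power \<rho>" using r by (auto simp: right_nat_action_def)
  note c = embedding_map_into_discrete_powerD(1)[OF e]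
  have \<nu>: "embedding_map T P \<nu>"
    unfolding P_def
  proof (rule embedding_map_into_discrete_powerI)
    show "inj_on \<nu> (topspace T)"
    proof (rule inj_onI)
      fix s t assume st: "s \<in> topspace T" "t \<in> topspace T" "\<nu> s = \<nu> t"
      \<comment> \<open>The relation \<open>\<nu> s\<close> holds at \<open>(\<rho> s b, b)\<close>,
        and \<open>\<nu> t\<close> holds there exactly when \<open>\<rho> t b = \<rho> s b\<close>.
        The same pairs turn finite sets of arguments into finite sets of coordinates in the
        neighbourhood condition.\<close>
      have "\<rho> s b = \<rho> t b" for b using fun_cong[OF st(3), of "(\<rho> s b, b)"] by (simp add: \<nu>_def)
      then show "s = t" using st inj_onD[OF embedding_map_imp_inj_on[OF e]] by blast
    qed
    show "continuous_map T (discrete_topology UNIV) (\<lambda>s. \<nu> s i)" for i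
      unfolding \<nu>_def case_prod_unfold by (rule continuous_map_discrete_comp[OF c])
    fix U s assume "openin T U" "s \<in> U"
    then obtain F where F: "finite F" "\<forall>t\<in>topspace T. (\<forall>b\<in>F. \<rho> t b = \<rho> s b) \<longrightarrow> t \<in> U"
      using embedding_map_into_discrete_powerD(2)[OF e] by blast
    then show "\<exists>F. finite F \<and> (\<forall>t\<in>topspace T. (\<forall>i\<in>F. \<nu> t i = \<nu> s i) \<longrightarrow> t \<in> U)"
      by (intro exI[of _ "(\<lambda>b. (\<rho> s b, b)) ` F"]) (simp add: \<nu>_def)
  qed
  have \<nu>C: "\<nu> ` topspace T \<subseteq> C"
    unfolding C_def by (rule closure_of_subset) (simp add: tP)
  have equiv: "\<nu> (s \<otimes>\<^bsub>M\<^esub> t) = act s (\<nu> t)" if "s \<in> carrier M" "t \<in> carrier M" for s t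
    using mult[OF that] by (auto simp: \<nu>_def act_def)
  have act: "continuous_map (prod_topology T P) P (\<lambda>(s, \<phi>). act s \<phi>)"
    unfolding P_def continuous_map_componentwise_UNIV
  proof
    fix i :: "nat \<times> nat"
    have "continuous_map (prod_topology T discrete_power) (discrete_topology UNIV)
        (\<lambda>p. snd p (fst i, \<rho> (fst p) (snd i)))"
    proof (rule continuous_map_discrete_dependent[where g = "\<lambda>m p. snd p (fst i, m)"])
      show "continuous_map (prod_topology T discrete_power) (discrete_topology UNIV) (\<lambda>p. \<rho> (fst p) (snd i))"
        using continuous_map_compose[OF continuous_map_fst c] by (simp add: o_def)
      show "continuous_map (prod_topology T discrete_power) (discrete_topology UNIV)
          (\<lambda>p. snd p (fst i, m))" for m
        using continuous_map_compose[OF continuous_map_snd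
            continuous_map_product_projection[of "(fst i, m)" UNIV "\<lambda>_. discrete_topology UNIV"]]
        by (simp add: o_def)
    qed
    then show "continuous_map (prod_topology T discrete_power) (discrete_topology UNIV)
        (\<lambda>p. (case p of (s, \<phi>) \<Rightarrow> act s \<phi>) i)"
      by (simp add: act_def case_prod_unfold)
  qed
  \<comment> \<open>By equivariance \<open>act s\<close> maps the orbit into itself, and continuity
    of \<open>act s\<close> extends this to the closure.\<close>
  have actC: "act s \<phi> \<in> C" if s: "s \<in> carrier M" and \<phi>: "\<phi> \<in> C" for s \<phi>
  proof -
    have "continuous_map P P (act s)"
      unfolding P_def continuous_map_componentwise_UNIV act_def case_prod_unfold
      by (intro allI continuous_map_product_projection) simp
    then have "act s ` C \<subseteq> P closure_of (act s ` \<nu> ` topspace T)"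
      unfolding C_def by (rule continuous_map_image_closure_subset)
    also have "\<dots> \<subseteq> C"
      unfolding C_def
    proof (rule closure_of_mono)
      show "act s ` \<nu> ` topspace T \<subseteq> \<nu> ` topspace T"
        using s equiv[OF s, symmetric] monoid.m_closed[OF M s] by (auto simp: T)
    qed
    finally show ?thesis using \<phi> by blast
  qed
  have "l_NA_witness M T (subtopology P C) act \<nu>"
    unfolding l_NA_witness_def
  proof (intro conjI ballI)
    show "stone_space (subtopology P C)"
      unfolding P_def
      by (intro stone_space_closed_subspace stone_space_discrete_power_bool)
        (simp add: C_def P_def closedin_closure_of)
    have "continuous_map (subtopology (prod_topology T P) (topspace T \<times> C)) P (\<lambda>(s, \<phi>). act s \<phi>)"
      using act by (rule continuous_map_from_subtopology)
    moreover have "prod_topology T (subtopology P C) = subtopology (prod_topology T P) (topspace T \<times> C)"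
      using prod_topology_subtopology(2)[of T P C]
      by (metis subtopology_Times subtopology_topspace)
    ultimately show "continuous_map (prod_topology T (subtopology P C)) (subtopology P C) (\<lambda>(s, \<phi>). act s \<phi>)"
      using actC by (auto simp: continuous_map_in_subtopology T)
    show "embedding_map T (subtopology P C) \<nu>"
      using \<nu> \<nu>C by (simp add: embedding_map_in_subtopology)
    show "subtopology P C closure_of \<nu> ` topspace T = topspace (subtopology P C)"
      using \<nu>C by (simp add: closure_of_subtopology C_def[symmetric] Int_absorb1 tP)
  qed (use equiv in \<open>auto simp: act_def one mult\<close>)
  \<comment> \<open>The witness lives over relations on \<nat>; \<open>l_NA_of_witness\<close> moves
    it to the type that \<open>l_NA\<close> prescribes.\<close>
  then show ?thesis
    by (rule l_NA_of_witness[OF right_nat_action_imp_topological_monoid[OF M T r]])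
qed

section \<open>Clopen sets and the compact-open topology\<close>

definition clopens :: "'a topology \<Rightarrow> 'a set set" where
  "clopens X = {B. openin X B \<and> closedin X B}"

lemma clopens_empty [simp]: "{} \<in> clopens X"
  by (simp add: clopens_def)

lemma clopens_diff: "B \<in> clopens X \<Longrightarrow> topspace X - B \<in> clopens X"
  by (auto simp: clopens_def)

lemma clopens_subset: "B \<in> clopens X \<Longrightarrow> B \<subseteq> topspace X"
  by (simp add: clopens_def openin_subset)

lemma clopens_finite_Union:
  "finite \<F> \<Longrightarrow> \<F> \<subseteq> clopens X \<Longrightarrow> \<Union>\<F> \<in> clopens X"
  unfolding clopens_def by (auto intro: closedin_Union)

lemma stone_space_clopen_nhd:
  assumes "stone_space X" "openin X U" "x \<in> U"
  obtains B where "B \<in> clopens X" "x \<in> B" "B \<subseteq> U"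
proof -
  from assms(1) obtain \<B> where B: "\<forall>V\<in>\<B>. openin X V \<and> closedin X V"
      "\<forall>U x. openin X U \<and> x \<in> U \<longrightarrow> (\<exists>V\<in>\<B>. x \<in> V \<and> V \<subseteq> U)"
    unfolding stone_space_def by (elim conjE exE)
  then obtain V where "V \<in> \<B>" "x \<in> V" "V \<subseteq> U" using assms(2,3) by blast
  then show thesis using B(1) that unfolding clopens_def by blast
qed

text \<open>Clopen subsets of \<open>U\<close> cover \<open>K\<close>, and a finite union of them is
  still clopen. In the compact-open topology this replaces a pair of a compact and an open set by a
  single clopen set.\<close>

lemma stone_space_clopen_between:
  assumes X: "stone_space X" and U: "openin X U" and K: "compactin X K" "K \<subseteq> U"
  obtains B where "B \<in> clopens X" "K \<subseteq> B" "B \<subseteq> U"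
proof -
  let ?\<U> = "{B \<in> clopens X. B \<subseteq> U}"
  have "K \<subseteq> \<Union>?\<U>"
  proof
    fix x assume "x \<in> K"
    then have "x \<in> U" using K(2) by blast
    then obtain B where "B \<in> clopens X" "x \<in> B" "B \<subseteq> U"
      by (rule stone_space_clopen_nhd[OF X U])
    then show "x \<in> \<Union>?\<U>" by blast
  qed
  moreover have "\<forall>B\<in>?\<U>. openin X B" by (simp add: clopens_def)
  ultimately obtain \<F> where F: "finite \<F>" "\<F> \<subseteq> ?\<U>" "K \<subseteq> \<Union>\<F>"
    using K(1) unfolding compactin_def by meson
  then have "\<Union>\<F> \<in> clopens X" by (intro clopens_finite_Union) auto
  moreover have "\<Union>\<F> \<subseteq> U" using F(2) by blast
  ultimately show thesis using F(3) by (intro that)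
qed

lemma stone_space_clopens_separate:
  assumes X: "stone_space X" and xy: "x \<in> topspace X" "y \<in> topspace X"
    and eq: "\<And>B. B \<in> clopens X \<Longrightarrow> x \<in> B \<longleftrightarrow> y \<in> B"
  shows "x = y"
proof (rule ccontr)
  assume "x \<noteq> y"
  moreover have "Hausdorff_space X" using X by (simp add: stone_space_def)
  ultimately obtain U V where "openin X U" "openin X V" "x \<in> U" "y \<in> V" "disjnt U V"
    using xy unfolding Hausdorff_space_def by metis
  then have U: "openin X U" "x \<in> U" "y \<notin> U" by (auto simp: disjnt_def)
  obtain B where B: "B \<in> clopens X" "x \<in> B" "B \<subseteq> U"
    by (rule stone_space_clopen_nhd[OF X U(1,2)])
  then have "y \<in> B" using eq[OF B(1)] by simp
  then show False using B(3) U(3) by blast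
qed

section \<open>Countable bases and countably many clopen sets\<close>

lemma metrizable_space_imp_second_countable:
  assumes "metrizable_space X" and "separable_space X \<or> compact_space X"
  shows "second_countable X"
proof -
  obtain M d where "Metric_space M d" and X: "X = Metric_space.mtopology M d"
    using assms(1) unfolding metrizable_space_def by blast
  then interpret Metric_space M d by simp
  \<comment> \<open>Both alternatives provide a countable net at every scale: a dense set in the
    separable case, a finite net in the compact case. Balls around the nets at the scales
    \<open>1 / Suc n\<close> then form a base.\<close>
  have "\<exists>C. countable C \<and> C \<subseteq> M \<and> M \<subseteq> (\<Union>c\<in>C. mball c \<epsilon>)" if e: "\<epsilon> > 0" for \<epsilon>
    using assms(2)
  proof
    assume "separable_space X"
    then obtain C where C: "countable C" "C \<subseteq> M" "mtopology closure_of C = M"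
      unfolding separable_space_def X by auto
    have "M \<subseteq> (\<Union>c\<in>C. mball c \<epsilon>)"
    proof
      fix x assume x: "x \<in> M"
      then have "x \<in> mtopology closure_of C" using C(3) by simp
      then obtain c where "c \<in> C" "c \<in> mball x \<epsilon>" using e unfolding metric_closure_of by auto
      then show "x \<in> (\<Union>c\<in>C. mball c \<epsilon>)" by (auto simp: commute)
    qed
    then show ?thesis using C by blast
  next
    assume "compact_space X"
    then have "mtotally_bounded M"
      unfolding X compact_space_def using compactin_imp_mtotally_bounded by simp
    then show ?thesis
      using e unfolding mtotally_bounded_def by (meson countable_finite)
  qed
  then have "\<exists>C. countable C \<and> C \<subseteq> M \<and> M \<subseteq> (\<Union>c\<in>C. mball c (inverse (real (Suc n))))" for n
    by simp
  then obtain C where C: "\<And>n. countable (C n)" "\<And>n. C n \<subseteq> M"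
      "\<And>n. M \<subseteq> (\<Union>c\<in>C n. mball c (inverse (real (Suc n))))"
    by metis
  let ?\<B> = "\<Union>n. (\<lambda>c. mball c (inverse (real (Suc n)))) ` C n"
  show ?thesis
    unfolding second_countable_def
  proof (intro exI[of _ ?\<B>] conjI ballI allI impI)
    show "countable ?\<B>" using C(1) by blast
    show "openin X V" if "V \<in> ?\<B>" for V using that X by auto
    fix U x assume U: "openin X U \<and> x \<in> U"
    then obtain r where r: "r > 0" "mball x r \<subseteq> U" and x: "x \<in> M"
      unfolding X openin_mtopology by blast
    obtain n where n: "inverse (real (Suc n)) < r / 2" using reals_Archimedean[of "r/2"] r by auto
    obtain c where c: "c \<in> C n" "x \<in> mball c (inverse (real (Suc n)))" using C(3) x by blast
    have "mball c (inverse (real (Suc n))) \<subseteq> mball x r"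
    proof
      fix y assume y: "y \<in> mball c (inverse (real (Suc n)))"
      have "d x y \<le> d x c + d c y" using c y x by (intro triangle) auto
      also have "\<dots> < r" using c y n by (auto simp: commute)
      finally show "y \<in> mball x r" using x y by simp
    qed
    then show "\<exists>V\<in>?\<B>. x \<in> V \<and> V \<subseteq> U" using c r(2) by blast
  qed
qed

text \<open>A clopen set is compact and open, hence a finite union of members of a countable base,
  and there are only countably many such unions.\<close>

lemma countable_clopens:
  assumes X: "stone_space X" and m: "metrizable_space X"
  shows "countable (clopens X)"
proof -
  have "second_countable X"
    using m X by (intro metrizable_space_imp_second_countable) (simp_all add: stone_space_def)
  then obtain \<B> where B: "countable \<B>" "\<forall>V\<in>\<B>. openin X V"
      "\<forall>U x. openin X U \<and> x \<in> U \<longrightarrow> (\<exists>V\<in>\<B>. x \<in> V \<and> V \<subseteq> U)"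
    unfolding second_countable_def by (elim exE conjE)
  have "A \<in> Union ` {\<F>. finite \<F> \<and> \<F> \<subseteq> \<B>}" if A: "A \<in> clopens X" for A
  proof -
    have "compactin X A"
      using A X unfolding clopens_def stone_space_def by (simp add: closedin_compact_space)
    moreover have "\<forall>V\<in>{V\<in>\<B>. V \<subseteq> A}. openin X V" using B(2) by blast
    moreover have "A \<subseteq> \<Union>{V\<in>\<B>. V \<subseteq> A}"
      using B(3) A unfolding clopens_def by blast
    ultimately obtain \<F> where F: "finite \<F>" "\<F> \<subseteq> {V\<in>\<B>. V \<subseteq> A}" "A \<subseteq> \<Union>\<F>"
      unfolding compactin_def by meson
    then have "A = \<Union>\<F>" by blast
    then show ?thesis using F by blast
  qed
  then have "clopens X \<subseteq> Union ` {\<F>. finite \<F> \<and> \<F> \<subseteq> \<B>}" by blast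
  then show ?thesis
    by (rule countable_subset) (intro countable_image countable_Collect_finite_subset B(1))
qed

section \<open>Preimage operators as coordinates of the compact-open topology\<close>

text \<open>Intersecting with \<open>topspace X\<close> discards the values of \<open>f\<close>
  outside the space: \<open>undefined\<close> for elements of \<open>cont_selfmaps\<close>,
  unspecified for the maps \<open>act s\<close>.\<close>

definition preimage_on :: "'a topology \<Rightarrow> ('a \<Rightarrow> 'b) \<Rightarrow> 'b set \<Rightarrow> 'a set" where
  "preimage_on X f B = {x \<in> topspace X. f x \<in> B}"

lemma preimage_on_clopens:
  "continuous_map X Y f \<Longrightarrow> B \<in> clopens Y \<Longrightarrow> preimage_on X f B \<in> clopens X"
  by (simp add: clopens_def preimage_on_def openin_continuous_map_preimage closedin_continuous_map_preimage)

lemma cont_selfmaps_eqI: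
  assumes Y: "stone_space Y" and f: "f \<in> cont_selfmaps Y" "g \<in> cont_selfmaps Y"
    and eq: "\<And>B. B \<in> clopens Y \<Longrightarrow> preimage_on Y f B = preimage_on Y g B"
  shows "f = g"
proof (rule extensionalityI)
  show "f \<in> extensional (topspace Y)" "g \<in> extensional (topspace Y)"
    using f by (auto simp: cont_selfmaps_def)
  fix y assume y: "y \<in> topspace Y"
  have "f y \<in> topspace Y" "g y \<in> topspace Y"
    using f y by (auto simp: cont_selfmaps_def continuous_map_def)
  then show "f y = g y"
    using eq y by (intro stone_space_clopens_separate[OF Y]) (auto simp: preimage_on_def)
qed

lemma topspace_compact_open_topology [simp]:
  "topspace (compact_open_topology Y) = cont_selfmaps Y"
proof -
  have "cont_selfmaps Y \<in> {{f \<in> cont_selfmaps Y. f ` K \<subseteq> U} | K U. compactin Y K \<and> openin Y U}"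
    by (intro CollectI exI[of _ "{}"]) auto
  then show ?thesis unfolding compact_open_topology_def by auto
qed

lemma openin_compact_open_topology:
  "compactin Y K \<Longrightarrow> openin Y U \<Longrightarrow>
    openin (compact_open_topology Y) {f \<in> cont_selfmaps Y. f ` K \<subseteq> U}"
  unfolding compact_open_topology_def by (intro topology_generated_by_Basis) blast

text \<open>Let \<open>A\<close> be the preimage of \<open>B\<close> under \<open>f\<close>. A
  self-map \<open>g\<close> has the same preimage exactly when it maps \<open>A\<close> into
  \<open>B\<close> and the complement of \<open>A\<close> into the complement of \<open>B\<close>.
  Both sources are compact and both targets open, so these are two subbasic conditions.\<close>

lemma continuous_map_preimage_on:
  assumes Y: "compact_space Y" and B: "B \<in> clopens Y"
  shows "continuous_map (compact_open_topology Y) (discrete_topology UNIV) (\<lambda>f. preimage_on Y f B)"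
  unfolding continuous_map_discrete_iff topspace_compact_open_topology
proof
  fix f assume f: "f \<in> cont_selfmaps Y"
  define A where "A = preimage_on Y f B"
  have A: "A \<in> clopens Y"
    using f B unfolding A_def cont_selfmaps_def by (blast intro: preimage_on_clopens)
  define U where "U = {g \<in> cont_selfmaps Y. g ` A \<subseteq> B} \<inter>
    {g \<in> cont_selfmaps Y. g ` (topspace Y - A) \<subseteq> topspace Y - B}"
  have "openin (compact_open_topology Y) U"
    unfolding U_def using A clopens_diff[OF A] B clopens_diff[OF B] Y
    by (intro openin_Int openin_compact_open_topology closedin_compact_space) (auto simp: clopens_def)
  moreover have "f \<in> U"
    using f unfolding U_def A_def preimage_on_def cont_selfmaps_def continuous_map_def by auto
  moreover have "preimage_on Y g B = A" if "g \<in> U" for g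
    using that clopens_subset[OF A] unfolding U_def preimage_on_def by blast
  ultimately show "\<exists>U. openin (compact_open_topology Y) U \<and> f \<in> U \<and>
      (\<forall>g\<in>U. preimage_on Y g B = preimage_on Y f B)"
    unfolding A_def by blast
qed

lemma compact_open_topology_nhd:
  assumes Y: "stone_space Y" and U: "openin (compact_open_topology Y) U" and f: "f \<in> U"
  shows "\<exists>F. finite F \<and> F \<subseteq> clopens Y \<and>
    (\<forall>g\<in>cont_selfmaps Y. (\<forall>B\<in>F. preimage_on Y g B = preimage_on Y f B) \<longrightarrow> g \<in> U)"
proof -
  have "generate_topology_on {{f \<in> cont_selfmaps Y. f ` K \<subseteq> U} | K U. compactin Y K \<and> openin Y U} U"
    using U unfolding compact_open_topology_def openin_topology_generated_by_iff .
  then show ?thesis using f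
  proof (induction rule: generate_topology_on.induct)
    case Empty
    then show ?case by simp
  next
    case (Int V W)
    then obtain F G where
      "finite F" "F \<subseteq> clopens Y" "\<forall>g\<in>cont_selfmaps Y. (\<forall>B\<in>F. preimage_on Y g B = preimage_on Y f B) \<longrightarrow> g \<in> V"
      "finite G" "G \<subseteq> clopens Y" "\<forall>g\<in>cont_selfmaps Y. (\<forall>B\<in>G. preimage_on Y g B = preimage_on Y f B) \<longrightarrow> g \<in> W"
      by blast
    then show ?case by (intro exI[of _ "F \<union> G"]) blast
  next
    case (UN \<U>)
    then obtain V where V: "V \<in> \<U>" "f \<in> V" by blast
    obtain F where "finite F" "F \<subseteq> clopens Y"
      "\<forall>g\<in>cont_selfmaps Y. (\<forall>B\<in>F. preimage_on Y g B = preimage_on Y f B) \<longrightarrow> g \<in> V"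
      using UN.IH[OF V] by (elim exE conjE)
    then show ?case using V(1) by (intro exI[of _ F]) blast
  next
    case (Basis V)
    then obtain K W where K: "compactin Y K" "openin Y W" and V: "V = {f \<in> cont_selfmaps Y. f ` K \<subseteq> W}"
      by blast
    have cf: "continuous_map Y Y f" and "f ` K \<subseteq> W"
      using Basis.prems V by (auto simp: cont_selfmaps_def)
    then obtain B where B: "B \<in> clopens Y" "f ` K \<subseteq> B" "B \<subseteq> W"
      using stone_space_clopen_between[OF Y K(2) image_compactin[OF K(1) cf]] by blast
    have "g \<in> V" if g: "g \<in> cont_selfmaps Y" "preimage_on Y g B = preimage_on Y f B" for g
    proof -
      have "K \<subseteq> preimage_on Y f B"
        using B(2) compactin_subset_topspace[OF K(1)] unfolding preimage_on_def by blast
      then have "g ` K \<subseteq> B" using g(2) unfolding preimage_on_def by blast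
      then show ?thesis using g(1) B(3) unfolding V by blast
    qed
    then show ?case using B(1) by (intro exI[of _ "{B}"]) blast
  qed
qed

section \<open>Coding countable index sets\<close>

text \<open>Codes that are not in use are fixed, so that the identity of \<open>I\<close> gives the identity of \<open>\<nat>\<close>
  also when \<open>I\<close> is finite.\<close>

definition index_code :: "'i set \<Rightarrow> ('i \<Rightarrow> 'i) \<Rightarrow> nat \<Rightarrow> nat" where
  "index_code I r n =
     (if n \<in> to_nat_on I ` I then to_nat_on I (r (from_nat_into I n)) else n)"

lemma index_code_to_nat_on:
  "countable I \<Longrightarrow> i \<in> I \<Longrightarrow> index_code I r (to_nat_on I i) = to_nat_on I (r i)"
  by (simp add: index_code_def)

text \<open>Transport of a right action from a countable index set to \<nat>. Both applications take
  families of clopen sets as indices: all clopen sets of a metrizable Stone space, and a countable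
  invariant family for an l-NA witness.\<close>

lemma right_nat_action_index_code:
  assumes I: "countable I" and T: "topspace T = carrier M"
    and closed: "\<And>s i. s \<in> carrier M \<Longrightarrow> i \<in> I \<Longrightarrow> r s i \<in> I"
    and one: "\<And>i. i \<in> I \<Longrightarrow> r \<one>\<^bsub>M\<^esub> i = i"
    and mult: "\<And>s t i. s \<in> carrier M \<Longrightarrow> t \<in> carrier M \<Longrightarrow> i \<in> I \<Longrightarrow> r (s \<otimes>\<^bsub>M\<^esub> t) i = r t (r s i)"
    and cont: "\<And>i. i \<in> I \<Longrightarrow> continuous_map T (discrete_topology UNIV) (\<lambda>s. r s i)"
    and inj: "\<And>s t. s \<in> carrier M \<Longrightarrow> t \<in> carrier M \<Longrightarrow> (\<And>i. i \<in> I \<Longrightarrow> r s i = r t i) \<Longrightarrow> s = t"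
    and nhd: "\<And>U s. openin T U \<Longrightarrow> s \<in> U \<Longrightarrow>
      \<exists>F. finite F \<and> F \<subseteq> I \<and> (\<forall>t\<in>carrier M. (\<forall>i\<in>F. r t i = r s i) \<longrightarrow> t \<in> U)"
  shows "right_nat_action M T (\<lambda>s. index_code I (r s))"
proof -
  let ?e = "to_nat_on I"
  note code = index_code_to_nat_on[OF I]
  \<comment> \<open>The coding is injective on \<open>I\<close> only, so invariance of
    \<open>I\<close> is needed to compare the two values.\<close>
  have decode: "r s i = r t i"
    if "s \<in> carrier M" "t \<in> carrier M" "i \<in> I" "index_code I (r s) (?e i) = index_code I (r t) (?e i)" for s t i
    using that closed I by (simp add: code)
  have "embedding_map T discrete_power (\<lambda>s. index_code I (r s))"
  proof (rule embedding_map_into_discrete_powerI)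
    show "inj_on (\<lambda>s. index_code I (r s)) (topspace T)"
    proof (rule inj_onI)
      fix s t assume st: "s \<in> topspace T" "t \<in> topspace T" "index_code I (r s) = index_code I (r t)"
      show "s = t"
      proof (rule inj)
        show "s \<in> carrier M" "t \<in> carrier M" using st(1,2) T by simp_all
        then show "r s i = r t i" if "i \<in> I" for i
          using that by (rule decode) (simp add: st(3))
      qed
    qed
    show "continuous_map T (discrete_topology UNIV) (\<lambda>s. index_code I (r s) n)" for n
    proof (cases "n \<in> ?e ` I")
      case True
      then obtain i where i: "i \<in> I" "n = ?e i" by blast
      then show ?thesis
        using continuous_map_discrete_comp[OF cont[OF i(1)], of ?e] by (simp add: code)
    qed (simp add: index_code_def)
    fix U s assume U: "openin T U" "s \<in> U"
    then have s: "s \<in> carrier M" using openin_subset T by blast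
    obtain F where F: "finite F" "F \<subseteq> I" "\<forall>t\<in>carrier M. (\<forall>i\<in>F. r t i = r s i) \<longrightarrow> t \<in> U"
      using nhd[OF U] by (elim exE conjE)
    have "t \<in> U"
      if t: "t \<in> carrier M" and eq: "\<forall>n\<in>?e ` F. index_code I (r t) n = index_code I (r s) n" for t
    proof -
      have "r t i = r s i" if "i \<in> F" for i
        using decode[OF t s] that eq F(2) by blast
      then show ?thesis using F(3) t by blast
    qed
    then show "\<exists>F. finite F \<and>
        (\<forall>t\<in>topspace T. (\<forall>n\<in>F. index_code I (r t) n = index_code I (r s) n) \<longrightarrow> t \<in> U)"
      using F(1) T by (intro exI[of _ "?e ` F"]) simp
  qed
  moreover have "index_code I (r \<one>\<^bsub>M\<^esub>) = id"
  proof
    show "index_code I (r \<one>\<^bsub>M\<^esub>) n = id n" for n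
      by (cases "n \<in> ?e ` I") (auto simp: code one, simp add: index_code_def)
  qed
  moreover have "index_code I (r (s \<otimes>\<^bsub>M\<^esub> t)) = index_code I (r t) \<circ> index_code I (r s)"
    if st: "s \<in> carrier M" "t \<in> carrier M" for s t
  proof
    show "index_code I (r (s \<otimes>\<^bsub>M\<^esub> t)) n = (index_code I (r t) \<circ> index_code I (r s)) n" for n
      using st by (cases "n \<in> ?e ` I") (auto simp: code mult closed, simp add: index_code_def)
  qed
  ultimately show ?thesis by (simp add: right_nat_action_def)
qed

text \<open>The index set is the countable family of all clopen sets. Its preimage coordinates are
  continuous by \<open>continuous_map_preimage_on\<close>, and they recover the topology by
  \<open>compact_open_topology_nhd\<close>.\<close>

lemma right_nat_action_selfmaps:
  assumes Y: "stone_space Y" and m: "metrizable_space Y" and S: "submonoid S (selfmap_monoid Y)"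
  shows "right_nat_action ((selfmap_monoid Y)\<lparr>carrier := S\<rparr>) (subtopology (compact_open_topology Y) S)
     (\<lambda>s. index_code (clopens Y) (preimage_on Y s))"
proof -
  have SC: "S \<subseteq> cont_selfmaps Y" and one: "(\<lambda>y\<in>topspace Y. y) \<in> S"
    using submonoid.subset[OF S] submonoid.one_closed[OF S] by (auto simp: selfmap_monoid_def)
  have cS: "continuous_map Y Y s" if "s \<in> S" for s using that SC by (auto simp: cont_selfmaps_def)
  have Yc: "compact_space Y" using Y by (simp add: stone_space_def)
  show ?thesis
  proof (rule right_nat_action_index_code)
    show "countable (clopens Y)"
      using Y m by (rule countable_clopens)
    show "topspace (subtopology (compact_open_topology Y) S) = carrier ((selfmap_monoid Y)\<lparr>carrier := S\<rparr>)"
      using SC by auto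
    show "preimage_on Y s B \<in> clopens Y"
      if "s \<in> carrier ((selfmap_monoid Y)\<lparr>carrier := S\<rparr>)" "B \<in> clopens Y" for s B
      using that cS by (auto intro: preimage_on_clopens)
    show "preimage_on Y \<one>\<^bsub>(selfmap_monoid Y)\<lparr>carrier := S\<rparr>\<^esub> B = B" if "B \<in> clopens Y" for B
      using clopens_subset[OF that] by (auto simp: selfmap_monoid_def preimage_on_def)
    show "preimage_on Y (s \<otimes>\<^bsub>(selfmap_monoid Y)\<lparr>carrier := S\<rparr>\<^esub> t) B = preimage_on Y t (preimage_on Y s B)"
      if "s \<in> carrier ((selfmap_monoid Y)\<lparr>carrier := S\<rparr>)"
        "t \<in> carrier ((selfmap_monoid Y)\<lparr>carrier := S\<rparr>)" for s t B
    proof -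
      have "t y \<in> topspace Y" if "y \<in> topspace Y" for y
        using cS[of t] that \<open>t \<in> carrier _\<close> by (auto simp: continuous_map_def)
      then show ?thesis by (auto simp: selfmap_monoid_def preimage_on_def compose_def)
    qed
    show "continuous_map (subtopology (compact_open_topology Y) S) (discrete_topology UNIV)
        (\<lambda>s. preimage_on Y s B)" if "B \<in> clopens Y" for B
      using continuous_map_preimage_on[OF Yc that] by (rule continuous_map_from_subtopology)
    show "s = t"
      if "s \<in> carrier ((selfmap_monoid Y)\<lparr>carrier := S\<rparr>)"
        "t \<in> carrier ((selfmap_monoid Y)\<lparr>carrier := S\<rparr>)"
        "\<And>B. B \<in> clopens Y \<Longrightarrow> preimage_on Y s B = preimage_on Y t B" for s t
      using that SC by (intro cont_selfmaps_eqI[OF Y]) auto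
    fix U s assume "openin (subtopology (compact_open_topology Y) S) U" "s \<in> U"
    then obtain V where V: "openin (compact_open_topology Y) V" "U = V \<inter> S" "s \<in> V"
      unfolding openin_subtopology by blast
    obtain F where "finite F" "F \<subseteq> clopens Y"
      "\<forall>g\<in>cont_selfmaps Y. (\<forall>B\<in>F. preimage_on Y g B = preimage_on Y s B) \<longrightarrow> g \<in> V"
      using compact_open_topology_nhd[OF Y V(1,3)] by (elim exE conjE)
    then show "\<exists>F. finite F \<and> F \<subseteq> clopens Y \<and> (\<forall>t\<in>carrier ((selfmap_monoid Y)\<lparr>carrier := S\<rparr>).
        (\<forall>B\<in>F. preimage_on Y t B = preimage_on Y s B) \<longrightarrow> t \<in> U)"
      using SC V(2) by (intro exI[of _ F]) auto
  qed
qed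

section \<open>The Cantor cube\<close>

lemma topspace_cantor_cube [simp]: "topspace cantor_cube = UNIV"
  by (simp add: cantor_cube_def)

lemma stone_space_cantor_cube: "stone_space cantor_cube"
  unfolding cantor_cube_def by (rule stone_space_discrete_power_bool)

lemma metrizable_space_cantor_cube: "metrizable_space cantor_cube"
  by (simp add: cantor_cube_def metrizable_space_product_topology)

lemma continuous_map_into_cantor_cube_iff:
  "continuous_map X cantor_cube f \<longleftrightarrow> (\<forall>n. {x \<in> topspace X. f x n} \<in> clopens X)"
proof -
  have "continuous_map X (discrete_topology UNIV) p \<longleftrightarrow> {x \<in> topspace X. p x} \<in> clopens X" for p
  proof
    assume p: "continuous_map X (discrete_topology UNIV) p"
    show "{x \<in> topspace X. p x} \<in> clopens X"
      using preimage_on_clopens[OF p, of "{True}"] by (simp add: preimage_on_def clopens_def)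
  next
    assume B: "{x \<in> topspace X. p x} \<in> clopens X"
    have "topspace X - {x \<in> topspace X. p x} = {x \<in> topspace X. \<not> p x}" by blast
    then have "openin X {x \<in> topspace X. p x}" "openin X {x \<in> topspace X. \<not> p x}"
      using B clopens_diff[OF B] by (simp_all add: clopens_def)
    then show "continuous_map X (discrete_topology UNIV) p"
      unfolding continuous_map_discrete_iff by blast
  qed
  then show ?thesis by (simp add: cantor_cube_def continuous_map_componentwise_UNIV)
qed

lemma cont_selfmaps_cantor_cube_iff:
  "f \<in> cont_selfmaps cantor_cube \<longleftrightarrow> (\<forall>n. {x. f x n} \<in> clopens cantor_cube)"
  by (simp add: cont_selfmaps_def continuous_map_into_cantor_cube_iff)

text \<open>Every point has a cylinder neighbourhood on which membership in \<open>B\<close> is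
  constant. Finitely many cylinders cover the cube, and the union of their finite supports works for
  \<open>B\<close>.\<close>

lemma clopens_cantor_cube_finite_support:
  assumes B: "B \<in> clopens cantor_cube"
  shows "\<exists>N. finite N \<and> (\<forall>x y. (\<forall>n\<in>N. x n = y n) \<longrightarrow> (x \<in> B \<longleftrightarrow> y \<in> B))"
proof -
  have "\<exists>N. finite N \<and> (\<forall>y. (\<forall>n\<in>N. y n = x n) \<longrightarrow> (y \<in> B \<longleftrightarrow> x \<in> B))" for x
  proof -
    \<comment> \<open>\<open>V\<close> is whichever of \<open>B\<close> and its complement contains
      \<open>x\<close>.\<close>
    obtain V where V: "V \<in> clopens cantor_cube" "x \<in> V" "V = B \<or> V = UNIV - B"
    proof (cases "x \<in> B")
      case False
      moreover have "UNIV - B \<in> clopens cantor_cube" using clopens_diff[OF B] by simp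
      ultimately show thesis using that[of "UNIV - B"] by blast
    qed (use B that in blast)
    have "openin discrete_power V" using V(1) by (simp add: clopens_def cantor_cube_def)
    from openin_discrete_power_nhd[OF this V(2)] show ?thesis using V(2,3) by blast
  qed
  then obtain N where N: "\<And>x. finite (N x)" "\<And>x y. \<forall>n\<in>N x. y n = x n \<Longrightarrow> y \<in> B \<longleftrightarrow> x \<in> B"
    by metis
  define W where "W x = {y. \<forall>n\<in>N x. y n \<in> {x n}}" for x
  have "openin cantor_cube (W x)" for x
    unfolding cantor_cube_def W_def using N(1) by (rule openin_discrete_power_cylinder)
  moreover have "topspace cantor_cube \<subseteq> \<Union>(range W)" by (auto simp: W_def)
  ultimately obtain \<F> where F: "finite \<F>" "\<F> \<subseteq> range W" "topspace cantor_cube \<subseteq> \<Union>\<F>"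
    using stone_space_cantor_cube unfolding stone_space_def compact_space_alt
    by (elim conjE allE[of _ "range W"]) auto
  then obtain D where D: "finite D" "\<F> = W ` D" by (meson finite_subset_image)
  \<comment> \<open>If \<open>x\<close> lies in \<open>W z\<close>, agreement on \<open>N z\<close>
    puts \<open>y\<close> there too, so both points are compared with the centre
    \<open>z\<close>.\<close>
  have support: "x \<in> B \<longleftrightarrow> y \<in> B" if eq: "\<forall>n\<in>\<Union>(N ` D). x n = y n" for x y
  proof -
    obtain z where z: "z \<in> D" "x \<in> W z" using F(3) D(2) by auto
    then have "x \<in> B \<longleftrightarrow> z \<in> B" using N(2)[of z x] by (auto simp: W_def)
    moreover have "y \<in> B \<longleftrightarrow> z \<in> B" using N(2)[of z y] z eq by (force simp: W_def)
    ultimately show ?thesis by simp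
  qed
  have "finite (\<Union>(N ` D))" using D N(1) by blast
  then show ?thesis using support by blast
qed

text \<open>Preimages of the coordinate sets \<open>{x. x n}\<close> suffice as coordinates: every
  clopen set depends on finitely many \<open>n\<close>, so its preimage is determined by finitely
  many of these.\<close>

lemma embedding_map_cantor_selfmaps:
  "embedding_map (compact_open_topology cantor_cube) discrete_power (\<lambda>f n. {x. f x n})"
proof (rule embedding_map_into_discrete_powerI)
  show "inj_on (\<lambda>f n. {x. f x n}) (topspace (compact_open_topology cantor_cube))"
  proof (rule inj_onI)
    fix f g :: "(nat \<Rightarrow> bool) \<Rightarrow> nat \<Rightarrow> bool"
    assume eq: "(\<lambda>n. {x. f x n}) = (\<lambda>n. {x. g x n})"
    have "f x n = g x n" for x n using fun_cong[OF eq, of n] by blast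
    then show "f = g" by blast
  qed
  show "continuous_map (compact_open_topology cantor_cube) (discrete_topology UNIV) (\<lambda>f. {x. f x n})" for n
  proof -
    have "compact_space cantor_cube" using stone_space_cantor_cube by (simp add: stone_space_def)
    moreover have "{x. x n} \<in> clopens cantor_cube"
      using continuous_map_into_cantor_cube_iff[of cantor_cube id] by simp
    ultimately have "continuous_map (compact_open_topology cantor_cube) (discrete_topology UNIV)
        (\<lambda>f. preimage_on cantor_cube f {x. x n})"
      by (rule continuous_map_preimage_on)
    then show ?thesis by (simp add: preimage_on_def)
  qed
  fix U f assume U: "openin (compact_open_topology cantor_cube) U" "f \<in> U"
  obtain F where F: "finite F" "F \<subseteq> clopens cantor_cube" "\<forall>g\<in>cont_selfmaps cantor_cube.
      (\<forall>B\<in>F. preimage_on cantor_cube g B = preimage_on cantor_cube f B) \<longrightarrow> g \<in> U"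
    using compact_open_topology_nhd[OF stone_space_cantor_cube U] by (elim exE conjE)
  have "\<exists>N. finite N \<and> (\<forall>x y. (\<forall>n\<in>N. x n = y n) \<longrightarrow> (x \<in> B \<longleftrightarrow> y \<in> B))" if "B \<in> F" for B
    using clopens_cantor_cube_finite_support that F(2) by blast
  then obtain N where N: "\<And>B. B \<in> F \<Longrightarrow> finite (N B)"
      "\<And>B x y. B \<in> F \<Longrightarrow> \<forall>n\<in>N B. x n = y n \<Longrightarrow> x \<in> B \<longleftrightarrow> y \<in> B"
    by metis
  have "g \<in> U"
    if g: "g \<in> cont_selfmaps cantor_cube" "\<forall>n\<in>\<Union>(N ` F). {x. g x n} = {x. f x n}" for g
  proof -
    have "preimage_on cantor_cube g B = preimage_on cantor_cube f B" if B: "B \<in> F" for B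
    proof -
      have "\<forall>n\<in>N B. g x n = f x n" for x using g(2) B by blast
      then have "g x \<in> B \<longleftrightarrow> f x \<in> B" for x using N(2)[OF B] by blast
      then show ?thesis by (simp add: preimage_on_def)
    qed
    then show ?thesis using F(3) g(1) by blast
  qed
  moreover have "finite (\<Union>(N ` F))" using F(1) N(1) by blast
  ultimately show "\<exists>F. finite F \<and> (\<forall>g\<in>topspace (compact_open_topology cantor_cube).
      (\<forall>n\<in>F. {x. g x n} = {x. f x n}) \<longrightarrow> g \<in> U)"
    by (intro exI[of _ "\<Union>(N ` F)"]) simp
qed

lemma polish_space_cantor_selfmaps: "polish_space (compact_open_topology cantor_cube)"
  unfolding polish_space_def
proof
  let ?C = "clopens cantor_cube" and ?\<sigma> = "\<lambda>f n. {x :: nat \<Rightarrow> bool. f x (n :: nat)}"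
  \<comment> \<open>The coordinates of a continuous self-map can be prescribed independently by
    arbitrary clopen sets. The monoid is therefore homeomorphic to a countable power of a discrete
    space, which is completely metrizable.\<close>
  have im: "?\<sigma> ` cont_selfmaps cantor_cube = (\<Pi>\<^sub>E n\<in>(UNIV :: nat set). ?C)"
  proof (intro equalityI subsetI)
    fix A assume A: "A \<in> (\<Pi>\<^sub>E n\<in>(UNIV :: nat set). ?C)"
    then have "(\<lambda>x n. x \<in> A n) \<in> cont_selfmaps cantor_cube"
      by (simp add: cont_selfmaps_cantor_cube_iff PiE_iff)
    then show "A \<in> ?\<sigma> ` cont_selfmaps cantor_cube"
      by (intro image_eqI[of A ?\<sigma> "\<lambda>x n. x \<in> A n"]) simp
  qed (auto simp: cont_selfmaps_cantor_cube_iff PiE_iff)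
  have "compact_open_topology cantor_cube homeomorphic_space subtopology discrete_power (\<Pi>\<^sub>E n\<in>(UNIV :: nat set). ?C)"
    using embedding_map_imp_homeomorphic_space[OF embedding_map_cantor_selfmaps] im by simp
  also have "subtopology discrete_power (\<Pi>\<^sub>E n\<in>(UNIV :: nat set). ?C) =
      product_topology (\<lambda>n::nat. discrete_topology ?C) UNIV"
    by (simp add: subtopology_product_topology)
  finally have "compact_open_topology cantor_cube homeomorphic_space
      product_topology (\<lambda>n::nat. discrete_topology ?C) UNIV" .
  moreover have "completely_metrizable_space (product_topology (\<lambda>n::nat. discrete_topology ?C) UNIV)"
    by (simp add: completely_metrizable_space_product_topology completely_metrizable_space_discrete_topology)
  ultimately show "completely_metrizable_space (compact_open_topology cantor_cube)"
    using homeomorphic_completely_metrizable_space by blast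
  \<comment> \<open>Candidates for a countable dense set: the list prescribes the first coordinates,
    and all later ones are constantly \<open>False\<close>, which corresponds to the clopen set
    \<open>{}\<close>.\<close>
  define k where "k l x n = (n < length l \<and> x \<in> l ! n)" for l :: "(nat \<Rightarrow> bool) set list" and x n
  have k: "k l \<in> cont_selfmaps cantor_cube" if "l \<in> lists ?C" for l
    unfolding cont_selfmaps_cantor_cube_iff
  proof
    show "{x. k l x n} \<in> ?C" for n
      using that by (cases "n < length l") (auto simp: k_def)
  qed
  show "separable_space (compact_open_topology cantor_cube)"
    unfolding separable_space_def
  proof (intro exI[of _ "k ` lists ?C"] conjI)
    have "countable ?C"
      using stone_space_cantor_cube metrizable_space_cantor_cube by (rule countable_clopens)
    then show "countable (k ` lists ?C)" by (intro countable_image countable_lists)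
    show "k ` lists ?C \<subseteq> topspace (compact_open_topology cantor_cube)" using k by auto
    show "compact_open_topology cantor_cube closure_of k ` lists ?C =
        topspace (compact_open_topology cantor_cube)"
    proof (rule equalityI[OF closure_of_subset_topspace subsetI])
      fix f assume f: "f \<in> topspace (compact_open_topology cantor_cube)"
      have "\<exists>g. g \<in> k ` lists ?C \<and> g \<in> U" if U: "openin (compact_open_topology cantor_cube) U" "f \<in> U" for U
      proof -
        obtain F where F: "finite F" "\<forall>g\<in>cont_selfmaps cantor_cube. (\<forall>n\<in>F. {x. g x n} = {x. f x n}) \<longrightarrow> g \<in> U"
          using embedding_map_into_discrete_powerD(2)[OF embedding_map_cantor_selfmaps U] by auto
        obtain m where m: "F \<subseteq> {..<m}" using F(1) finite_nat_iff_bounded by blast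
        \<comment> \<open>Truncating \<open>f\<close> after \<open>m\<close> coordinates keeps every
          coordinate in \<open>F\<close>, on which membership in \<open>U\<close> depends.\<close>
        let ?l = "map (\<lambda>n. {x. f x n}) [0..<m]"
        have l: "?l \<in> lists ?C" using f by (auto simp: cont_selfmaps_cantor_cube_iff)
        have "\<forall>n\<in>F. {x. k ?l x n} = {x. f x n}" using m by (auto simp: k_def)
        then have "k ?l \<in> U" using F(2) k[OF l] by blast
        then show ?thesis using l by blast
      qed
      then show "f \<in> compact_open_topology cantor_cube closure_of k ` lists ?C"
        using f unfolding in_closure_of by blast
    qed
  qed
qed

text \<open>Reindexing undoes the reversal: \<open>x \<circ> \<rho> (s \<otimes> t) = (x \<circ>
  \<rho> t) \<circ> \<rho> s\<close>. The identity goes to the identity because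
  \<open>\<rho> \<one> = id\<close>. Topologically, coordinate \<open>n\<close> of the image of
  \<open>s\<close> is the set \<open>{x. x (\<rho> s n)}\<close>, which carries the same information
  as \<open>\<rho> s n\<close>.\<close>

lemma right_nat_action_imp_embedding:
  assumes T: "topspace T = carrier M" and r: "right_nat_action M T \<rho>"
  shows "topological_monoid_embedding M T (selfmap_monoid cantor_cube) (compact_open_topology cantor_cube)
     (\<lambda>s x. x \<circ> \<rho> s)"
proof -
  have one: "\<rho> \<one>\<^bsub>M\<^esub> = id"
    and mult: "\<And>s t. s \<in> carrier M \<Longrightarrow> t \<in> carrier M \<Longrightarrow> \<rho> (s \<otimes>\<^bsub>M\<^esub> t) = \<rho> t \<circ> \<rho> s"
    and e: "embedding_map T discrete_power \<rho>" using r by (auto simp: right_nat_action_def)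
  have sel: "(\<lambda>x. x \<circ> \<rho> s) \<in> cont_selfmaps cantor_cube" for s
    unfolding cont_selfmaps_cantor_cube_iff
    using continuous_map_into_cantor_cube_iff[of cantor_cube id] by simp
  have "embedding_map T (compact_open_topology cantor_cube) (\<lambda>s x. x \<circ> \<rho> s)"
  proof (rule embedding_map_cancel_left[OF embedding_map_cantor_selfmaps])
    \<comment> \<open>The indicator of \<open>{a}\<close> belongs to the first set, and to the
      second only if \<open>b = a\<close>.\<close>
    have inj: "a = b" if "{x :: nat \<Rightarrow> bool. x a} = {x. x b}" for a b
      using that[THEN eqset_imp_iff, of "\<lambda>n. n = a"] by simp
    have "embedding_map T discrete_power (\<lambda>s n. {x :: nat \<Rightarrow> bool. x (\<rho> s n)})"
    proof (rule embedding_map_into_discrete_powerI)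
      show "inj_on (\<lambda>s n. {x :: nat \<Rightarrow> bool. x (\<rho> s n)}) (topspace T)"
      proof (rule inj_onI)
        fix s t assume st: "s \<in> topspace T" "t \<in> topspace T"
          and eq: "(\<lambda>n. {x :: nat \<Rightarrow> bool. x (\<rho> s n)}) = (\<lambda>n. {x. x (\<rho> t n)})"
        have "\<rho> s n = \<rho> t n" for n using inj fun_cong[OF eq] by blast
        then show "s = t" using st inj_onD[OF embedding_map_imp_inj_on[OF e]] by blast
      qed
      show "continuous_map T (discrete_topology UNIV) (\<lambda>s. {x :: nat \<Rightarrow> bool. x (\<rho> s n)})" for n
        by (rule continuous_map_discrete_comp[OF embedding_map_into_discrete_powerD(1)[OF e]])
      fix U s assume U: "openin T U" "s \<in> U"
      show "\<exists>F. finite F \<and> (\<forall>t\<in>topspace T. (\<forall>n\<in>F. {x :: nat \<Rightarrow> bool. x (\<rho> t n)} = {x. x (\<rho> s n)}) \<longrightarrow> t \<in> U)"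
        using embedding_map_into_discrete_powerD(2)[OF e U] inj by meson
    qed
    then show "embedding_map T discrete_power ((\<lambda>f n. {x. f x n}) \<circ> (\<lambda>s x. x \<circ> \<rho> s))"
      by (simp add: o_def)
  qed (use sel in auto)
  then show ?thesis
    using sel unfolding topological_monoid_embedding_def
    by (auto simp: hom_def selfmap_monoid_def one mult compose_def fun_eq_iff)
qed

section \<open>Separable metrizable l-NA monoids\<close>

text \<open>Each value is taken on a nonempty open set, hence already on a countable dense set.
  Applied to preimages under an action, this makes the orbit of each clopen set countable.\<close>

lemma countable_image_continuous_map_discrete:
  assumes X: "separable_space X" and g: "continuous_map X (discrete_topology UNIV) g"
  shows "countable (g ` topspace X)"
proof -
  obtain C where C: "countable C" "X closure_of C = topspace X"
    using X unfolding separable_space_def by blast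
  have "g ` topspace X \<subseteq> g ` C"
  proof
    fix a assume "a \<in> g ` topspace X"
    then obtain x where x: "x \<in> topspace X" "a = g x" by blast
    then obtain U where U: "openin X U" "x \<in> U" "\<forall>y\<in>U. g y = g x"
      using g unfolding continuous_map_discrete_iff by blast
    then obtain c where "c \<in> C" "c \<in> U" using C(2) x(1) unfolding closure_of_def by blast
    moreover from this have "a = g c" using U(3) x(2) by simp
    ultimately show "a \<in> g ` C" by blast
  qed
  then show ?thesis using C(1) by (meson countable_image countable_subset)
qed

text \<open>\<open>Z\<close> itself need not be metrizable, so it may have uncountably many clopen
  sets. One clopen set is chosen for each pair of basic open sets of \<open>X\<close> that admits a
  clopen trace between them; there are only countably many pairs.\<close>

lemma countable_clopens_base:
  assumes Z: "stone_space Z" and e: "embedding_map X Z \<nu>" and X: "second_countable X"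
  shows "\<exists>\<B>. countable \<B> \<and> \<B> \<subseteq> clopens Z \<and>
    (\<forall>U x. openin X U \<and> x \<in> U \<longrightarrow> (\<exists>B\<in>\<B>. \<nu> x \<in> B \<and> (\<forall>y\<in>topspace X. \<nu> y \<in> B \<longrightarrow> y \<in> U)))"
proof -
  obtain \<U> where U: "countable \<U>" "\<forall>V\<in>\<U>. openin X V"
      "\<forall>U x. openin X U \<and> x \<in> U \<longrightarrow> (\<exists>V\<in>\<U>. x \<in> V \<and> V \<subseteq> U)"
    using X unfolding second_countable_def by (elim exE conjE)
  define between where "between V W B \<longleftrightarrow> B \<in> clopens Z \<and> V \<subseteq> {x \<in> topspace X. \<nu> x \<in> B} \<and>
    {x \<in> topspace X. \<nu> x \<in> B} \<subseteq> W" for V W B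
  define pick where "pick = (\<lambda>(V, W). SOME B. between V W B)"
  define I where "I = {(V, W) \<in> \<U> \<times> \<U>. \<exists>B. between V W B}"
  have pick: "between V W (pick (V, W))" if "(V, W) \<in> I" for V W
    using that unfolding pick_def I_def by (auto intro: someI)
  show ?thesis
  proof (intro exI[of _ "pick ` I"] conjI allI impI)
    have "countable (\<U> \<times> \<U>)" using U(1) by blast
    then have "countable I" by (rule countable_subset[rotated]) (auto simp: I_def)
    then show "countable (pick ` I)" by blast
    show "pick ` I \<subseteq> clopens Z" using pick unfolding between_def by auto
    fix U x assume xU: "openin X U \<and> x \<in> U"
    obtain W where W: "W \<in> \<U>" "x \<in> W" "W \<subseteq> U" using U(3) xU by blast
    have "openin X W" using U(2) W(1) by blast
    then obtain O' where O': "openin Z O'" "W = {x \<in> topspace X. \<nu> x \<in> O'}"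
      by (rule embedding_map_openin_preimage[OF e])
    have x: "x \<in> topspace X" "\<nu> x \<in> O'" using W(2) O'(2) by auto
    obtain B where B: "B \<in> clopens Z" "\<nu> x \<in> B" "B \<subseteq> O'"
      by (rule stone_space_clopen_nhd[OF Z O'(1) x(2)])
    have "openin X {x \<in> topspace X. \<nu> x \<in> B}"
      using embedding_map_imp_continuous_map[OF e] B(1)
      by (simp add: clopens_def openin_continuous_map_preimage)
    then obtain V where V: "V \<in> \<U>" "x \<in> V" "V \<subseteq> {x \<in> topspace X. \<nu> x \<in> B}"
      using U(3)[rule_format, of "{x \<in> topspace X. \<nu> x \<in> B}" x] x(1) B(2) by blast
    \<comment> \<open>\<open>B\<close> only shows that the pair \<open>(V, W)\<close> is admissible.
      The chosen set may differ from \<open>B\<close>, but its trace still contains \<open>x\<close>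
      and lies inside \<open>W\<close>.\<close>
    have "between V W B" using B V(3) O'(2) unfolding between_def by blast
    then have I: "(V, W) \<in> I" using V(1) W(1) unfolding I_def by blast
    then have "between V W (pick (V, W))" by (rule pick)
    then have "\<nu> x \<in> pick (V, W)" "\<forall>y\<in>topspace X. \<nu> y \<in> pick (V, W) \<longrightarrow> y \<in> U"
      using V(2) W(3) unfolding between_def by blast+
    then show "\<exists>B\<in>pick ` I. \<nu> x \<in> B \<and> (\<forall>y\<in>topspace X. \<nu> y \<in> B \<longrightarrow> y \<in> U)"
      using I by blast
  qed
qed

text \<open>As in \<open>continuous_map_preimage_on\<close>, two inclusions fix the preimage. Here
  compactness of clopen sets, joint continuity and the tube lemma show that each inclusion persists
  for all \<open>t\<close> near \<open>s\<close>.\<close>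

lemma continuous_map_preimage_on_action:
  assumes Z: "compact_space Z" and B: "B \<in> clopens Z"
    and act: "continuous_map (prod_topology T Z) Z (\<lambda>(s, z). act s z)"
  shows "continuous_map T (discrete_topology UNIV) (\<lambda>s. preimage_on Z (act s) B)"
  unfolding continuous_map_discrete_iff
proof
  fix s assume s: "s \<in> topspace T"
  define A where "A = preimage_on Z (act s) B"
  have slice: "continuous_map Z Z (act s)"
    using continuous_map_compose[OF _ act, of Z "Pair s"] s
    by (simp add: o_def continuous_map_pairedI)
  have A: "A \<in> clopens Z" unfolding A_def by (rule preimage_on_clopens[OF slice B])
  have nhd: "\<exists>V. openin T V \<and> s \<in> V \<and> (\<forall>t\<in>V. \<forall>z\<in>A'. act t z \<in> B')"
    if A': "A' \<in> clopens Z" and B': "B' \<in> clopens Z" and AB: "\<forall>z\<in>A'. act s z \<in> B'" for A' B'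
  proof -
    let ?W = "{p \<in> topspace (prod_topology T Z). (case p of (s, z) \<Rightarrow> act s z) \<in> B'}"
    have "openin (prod_topology T Z) ?W"
      using B' by (intro openin_continuous_map_preimage[OF act]) (simp add: clopens_def)
    moreover have "compactin Z A'"
      using A' Z by (simp add: clopens_def closedin_compact_space)
    moreover have "{s} \<times> A' \<subseteq> ?W" using AB s clopens_subset[OF A'] by auto
    ultimately have "\<exists>V V'. openin T V \<and> openin Z V' \<and> s \<in> V \<and> A' \<subseteq> V' \<and> V \<times> V' \<subseteq> ?W"
      using s by (intro tube_lemma_right)
    then obtain V V' where V: "openin T V" "s \<in> V" "A' \<subseteq> V'" "V \<times> V' \<subseteq> ?W"
      by (elim exE conjE)
    have "act t z \<in> B'" if "t \<in> V" "z \<in> A'" for t z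
    proof -
      have "(t, z) \<in> ?W" using V(3,4) that by blast
      then show ?thesis by simp
    qed
    then show ?thesis using V(1,2) by blast
  qed
  have "\<forall>z\<in>A. act s z \<in> B" by (simp add: A_def preimage_on_def)
  then obtain V where V: "openin T V" "s \<in> V" "\<forall>t\<in>V. \<forall>z\<in>A. act t z \<in> B"
    using nhd[OF A B] by blast
  have "\<forall>z\<in>topspace Z - A. act s z \<in> topspace Z - B"
    using continuous_map_image_subset_topspace[OF slice] by (auto simp: A_def preimage_on_def)
  then obtain W where W: "openin T W" "s \<in> W" "\<forall>t\<in>W. \<forall>z\<in>topspace Z - A. act t z \<in> topspace Z - B"
    using nhd[OF clopens_diff[OF A] clopens_diff[OF B]] by blast
  have "preimage_on Z (act t) B = A" if "t \<in> V \<inter> W" for t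
    using that V(3) W(3) clopens_subset[OF A] unfolding preimage_on_def by blast
  then show "\<exists>U. openin T U \<and> s \<in> U \<and> (\<forall>t\<in>U. preimage_on Z (act t) B = preimage_on Z (act s) B)"
    using V(1,2) W(1,2) unfolding A_def by (intro exI[of _ "V \<inter> W"]) blast
qed

lemma l_NA_witness_imp_right_nat_action:
  assumes M: "topological_monoid M T" and sep: "separable_space T" and met: "metrizable_space T"
    and w: "l_NA_witness M T Z act \<nu>"
  obtains \<rho> where "right_nat_action M T \<rho>"
proof -
  interpret monoid M using M by (simp add: topological_monoid_def)
  have T: "topspace T = carrier M" using M by (simp add: topological_monoid_def)
  have Z: "stone_space Z" and Zc: "compact_space Z"
    and act: "continuous_map (prod_topology T Z) Z (\<lambda>(s, z). act s z)" and e: "embedding_map T Z \<nu>"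
    using w by (auto simp: l_NA_witness_def stone_space_def)
  have act_one: "act \<one>\<^bsub>M\<^esub> z = z" if "z \<in> topspace Z" for z
    using w that by (simp add: l_NA_witness_def)
  have act_mult: "act (s \<otimes>\<^bsub>M\<^esub> t) z = act s (act t z)"
    if "s \<in> carrier M" "t \<in> carrier M" "z \<in> topspace Z" for s t z
    using w that unfolding l_NA_witness_def by blast
  have act_closed: "act s z \<in> topspace Z" if "s \<in> carrier M" "z \<in> topspace Z" for s z
  proof -
    have "(s, z) \<in> topspace (prod_topology T Z)" using that T by simp
    from funcset_mem[OF continuous_map_funspace[OF act] this] show ?thesis by simp
  qed
  \<comment> \<open>Equivariance applied to \<open>s = s \<otimes> \<one>\<close> makes the embedded
    monoid the orbit of a single point. Membership of \<open>\<nu> s\<close> in a clopen set is thus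
    read off from its preimage under \<open>s\<close>.\<close>
  have \<nu>_act: "\<nu> s = act s (\<nu> \<one>\<^bsub>M\<^esub>)" if "s \<in> carrier M" for s
    using w that r_one[OF that] one_closed unfolding l_NA_witness_def by metis
  have \<nu>_one: "\<nu> \<one>\<^bsub>M\<^esub> \<in> topspace Z"
    using funcset_mem[OF continuous_map_funspace[OF embedding_map_imp_continuous_map[OF e]]] T by simp
  let ?r = "\<lambda>s. preimage_on Z (act s)"
  have \<nu>_mem: "\<nu> s \<in> B \<longleftrightarrow> \<nu> \<one>\<^bsub>M\<^esub> \<in> ?r s B" if "s \<in> carrier M" for s B
    using \<nu>_act[OF that] \<nu>_one by (simp add: preimage_on_def)
  note cont = continuous_map_preimage_on_action[OF Zc _ act]
  have r_one: "?r \<one>\<^bsub>M\<^esub> B = B" if "B \<in> clopens Z" for B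
    using clopens_subset[OF that] act_one by (auto simp: preimage_on_def)
  have r_mult: "?r (s \<otimes>\<^bsub>M\<^esub> t) B = ?r t (?r s B)" if "s \<in> carrier M" "t \<in> carrier M" for s t B
    using that by (auto simp: preimage_on_def act_mult act_closed)
  have r_clopen: "?r s B \<in> clopens Z" if s: "s \<in> carrier M" and "B \<in> clopens Z" for s B
  proof (rule preimage_on_clopens[OF _ \<open>B \<in> clopens Z\<close>])
    show "continuous_map Z Z (act s)"
      using continuous_map_compose[OF _ act, of Z "Pair s"] s T
      by (simp add: o_def continuous_map_pairedI)
  qed
  obtain \<B> where B: "countable \<B>" "\<B> \<subseteq> clopens Z"
    and base: "\<forall>U x. openin T U \<and> x \<in> U \<longrightarrow>
      (\<exists>B\<in>\<B>. \<nu> x \<in> B \<and> (\<forall>y\<in>topspace T. \<nu> y \<in> B \<longrightarrow> y \<in> U))"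
    using countable_clopens_base[OF Z e metrizable_space_imp_second_countable[OF met disjI1[OF sep]]]
    by (elim exE conjE)
  \<comment> \<open>The smallest family that contains the chosen clopen sets and is invariant under
    preimages: \<open>\<one>\<close> puts \<open>\<B>\<close> into it, and a preimage of a preimage
    is the preimage under a product.\<close>
  define I where "I = (\<Union>B\<in>\<B>. (\<lambda>s. ?r s B) ` carrier M)"
  have I_clopen: "I \<subseteq> clopens Z" using r_clopen B(2) unfolding I_def by blast
  have BI: "\<B> \<subseteq> I"
  proof
    fix B assume "B \<in> \<B>"
    moreover have "B = ?r \<one>\<^bsub>M\<^esub> B" using r_one B(2) \<open>B \<in> \<B>\<close> by blast
    ultimately show "B \<in> I" using one_closed unfolding I_def by blast
  qed
  \<comment> \<open>A single coordinate already isolates a neighbourhood: equal preimages of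
    \<open>B\<close> contain the base point together, so \<open>\<nu> t\<close> lies in
    \<open>B\<close> along with \<open>\<nu> s\<close>.\<close>
  have nhd: "\<exists>B\<in>\<B>. \<forall>t\<in>carrier M. ?r t B = ?r s B \<longrightarrow> t \<in> U" if U: "openin T U" "s \<in> U" for U s
  proof -
    have s: "s \<in> carrier M" using openin_subset[OF U(1)] U(2) T by blast
    obtain B where B: "B \<in> \<B>" "\<nu> s \<in> B" "\<forall>t\<in>carrier M. \<nu> t \<in> B \<longrightarrow> t \<in> U"
      using base U T by metis
    have "t \<in> U" if t: "t \<in> carrier M" and eq: "?r t B = ?r s B" for t
    proof -
      have "\<nu> t \<in> B" using \<nu>_mem[OF t, of B] \<nu>_mem[OF s, of B] B(2) eq by simp
      then show ?thesis using B(3) t by blast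
    qed
    then show ?thesis using B(1) by blast
  qed
  have "right_nat_action M T (\<lambda>s. index_code I (?r s))"
  proof (rule right_nat_action_index_code[OF _ T])
    have "countable ((\<lambda>s. ?r s B) ` carrier M)" if "B \<in> \<B>" for B
    proof -
      have "B \<in> clopens Z" using that B(2) by blast
      from countable_image_continuous_map_discrete[OF sep cont[OF this]] show ?thesis by (simp add: T)
    qed
    then show "countable I" unfolding I_def using B(1) by blast
    show "?r s A \<in> I" if s: "s \<in> carrier M" and A: "A \<in> I" for s A
    proof -
      obtain B t where Bt: "B \<in> \<B>" "t \<in> carrier M" "A = ?r t B" using A unfolding I_def by blast
      then have "?r s A = ?r (t \<otimes>\<^bsub>M\<^esub> s) B" using r_mult s by simp
      then show ?thesis using Bt s unfolding I_def by blast
    qed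
    show "?r \<one>\<^bsub>M\<^esub> A = A" if "A \<in> I" for A using r_one that I_clopen by blast
    show "?r (s \<otimes>\<^bsub>M\<^esub> t) A = ?r t (?r s A)" if "s \<in> carrier M" "t \<in> carrier M" for s t A
      using that by (rule r_mult)
    show "continuous_map T (discrete_topology UNIV) (\<lambda>s. ?r s A)" if "A \<in> I" for A
      using I_clopen that by (intro cont) blast
    show "s = t"
      if st: "s \<in> carrier M" "t \<in> carrier M" and eq: "\<And>A. A \<in> I \<Longrightarrow> ?r s A = ?r t A" for s t
    proof (rule ccontr)
      assume "s \<noteq> t"
      moreover have "Hausdorff_space T" using met by (rule metrizable_imp_Hausdorff_space)
      ultimately obtain U V where UV: "openin T U" "openin T V" "s \<in> U" "t \<in> V" "disjnt U V"
        using st T unfolding Hausdorff_space_def by metis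
      obtain B where "B \<in> \<B>" "\<forall>t\<in>carrier M. ?r t B = ?r s B \<longrightarrow> t \<in> U"
        using nhd[OF UV(1,3)] by blast
      moreover from this have "?r t B = ?r s B" using eq BI by auto
      ultimately have "t \<in> U" using st(2) by blast
      then show False using UV(4,5) by (auto simp: disjnt_def)
    qed
    fix U s assume "openin T U" "s \<in> U"
    then obtain B where "B \<in> \<B>" "\<forall>t\<in>carrier M. ?r t B = ?r s B \<longrightarrow> t \<in> U" using nhd by blast
    then show "\<exists>F. finite F \<and> F \<subseteq> I \<and> (\<forall>t\<in>carrier M. (\<forall>A\<in>F. ?r t A = ?r s A) \<longrightarrow> t \<in> U)"
      using BI by (intro exI[of _ "{B}"]) auto
  qed
  then show thesis by (rule that)
qed

lemma metrizable_stone_space_embedding: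
  assumes Y: "stone_space Y" and m: "metrizable_space Y"
  defines "\<alpha> \<equiv> \<lambda>y n. n \<in> to_nat_on (clopens Y) ` clopens Y \<and> y \<in> from_nat_into (clopens Y) n"
  shows "embedding_map Y cantor_cube \<alpha>"
    and "continuous_map Y Y s \<Longrightarrow> y \<in> topspace Y \<Longrightarrow>
      \<alpha> (s y) = \<alpha> y \<circ> index_code (clopens Y) (preimage_on Y s)"
proof -
  have c: "countable (clopens Y)" using Y m by (rule countable_clopens)
  have \<alpha>: "\<alpha> y (to_nat_on (clopens Y) B) \<longleftrightarrow> y \<in> B" if "B \<in> clopens Y" for y B
    using that c by (simp add: \<alpha>_def)
  show "embedding_map Y cantor_cube \<alpha>"
    unfolding cantor_cube_def
  proof (rule embedding_map_into_discrete_powerI)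
    show "inj_on \<alpha> (topspace Y)"
    proof (rule inj_onI)
      fix x y assume "x \<in> topspace Y" "y \<in> topspace Y" "\<alpha> x = \<alpha> y"
      then show "x = y" using \<alpha> by (intro stone_space_clopens_separate[OF Y]) metis+
    qed
    have "continuous_map Y cantor_cube \<alpha>"
      unfolding continuous_map_into_cantor_cube_iff
    proof
      fix n
      show "{y \<in> topspace Y. \<alpha> y n} \<in> clopens Y"
      proof (cases "n \<in> to_nat_on (clopens Y) ` clopens Y")
        case True
        then obtain B where B: "B \<in> clopens Y" "n = to_nat_on (clopens Y) B" by blast
        then have "{y \<in> topspace Y. \<alpha> y n} = B" using \<alpha> clopens_subset[OF B(1)] by auto
        then show ?thesis using B(1) by simp
      qed (simp add: \<alpha>_def)
    qed
    then show "continuous_map Y (discrete_topology UNIV) (\<lambda>y. \<alpha> y n)" for n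
      by (simp add: cantor_cube_def continuous_map_componentwise_UNIV)
    fix U y assume U: "openin Y U" "y \<in> U"
    obtain B where B: "B \<in> clopens Y" "y \<in> B" "B \<subseteq> U" by (rule stone_space_clopen_nhd[OF Y U])
    then show "\<exists>F. finite F \<and> (\<forall>x\<in>topspace Y. (\<forall>n\<in>F. \<alpha> x n = \<alpha> y n) \<longrightarrow> x \<in> U)"
      using \<alpha>[OF B(1)] by (intro exI[of _ "{to_nat_on (clopens Y) B}"]) auto
  qed
  assume s: "continuous_map Y Y s" and y: "y \<in> topspace Y"
  show "\<alpha> (s y) = \<alpha> y \<circ> index_code (clopens Y) (preimage_on Y s)"
  proof
    fix n
    show "\<alpha> (s y) n = (\<alpha> y \<circ> index_code (clopens Y) (preimage_on Y s)) n"
    proof (cases "n \<in> to_nat_on (clopens Y) ` clopens Y")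
      case True
      then obtain B where B: "B \<in> clopens Y" "n = to_nat_on (clopens Y) B" by blast
      then show ?thesis
        using y preimage_on_clopens[OF s B(1)]
        by (simp add: \<alpha> index_code_to_nat_on[OF c]) (simp add: preimage_on_def)
    qed (simp add: \<alpha>_def index_code_def)
  qed
qed

section \<open>Universality\<close>

lemma monoid_selfmap_monoid: "monoid (selfmap_monoid Y)"
proof (rule monoidI; unfold selfmap_monoid_def, simp_all)
  show "compose (topspace Y) f g \<in> cont_selfmaps Y" if "f \<in> cont_selfmaps Y" "g \<in> cont_selfmaps Y" for f g
  proof -
    have "continuous_map Y Y (f \<circ> g)" using that by (auto simp: cont_selfmaps_def intro: continuous_map_compose)
    then have "continuous_map Y Y (compose (topspace Y) f g)"
      by (rule continuous_map_eq) (simp add: compose_def)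
    then show ?thesis by (simp add: cont_selfmaps_def)
  qed
  show "(\<lambda>y\<in>topspace Y. y) \<in> cont_selfmaps Y"
    using continuous_map_eq[OF continuous_map_id, of Y "\<lambda>y\<in>topspace Y. y"]
    by (simp add: cont_selfmaps_def)
  fix f g h assume f: "f \<in> cont_selfmaps Y"
  have f': "f \<in> topspace Y \<rightarrow> topspace Y" "f \<in> extensional (topspace Y)"
    using f by (auto simp: cont_selfmaps_def continuous_map_def)
  show "compose (topspace Y) (\<lambda>y\<in>topspace Y. y) f = f" using f' by (rule Id_compose)
  show "compose (topspace Y) f (\<lambda>y\<in>topspace Y. y) = f" using f' by (rule compose_Id)
  assume "g \<in> cont_selfmaps Y" and h: "h \<in> cont_selfmaps Y"
  have "h \<in> topspace Y \<rightarrow> topspace Y" using h by (simp add: cont_selfmaps_def continuous_map_def)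
  then show "compose (topspace Y) (compose (topspace Y) f g) h = compose (topspace Y) f (compose (topspace Y) g h)"
    by (rule compose_assoc[symmetric])
qed

lemma right_nat_action_cantor_selfmaps:
  obtains \<rho> where "right_nat_action (selfmap_monoid cantor_cube) (compact_open_topology cantor_cube) \<rho>"
proof -
  let ?M = "selfmap_monoid cantor_cube"
  have "submonoid (carrier ?M) ?M"
    using monoid_selfmap_monoid[of cantor_cube]
    by (simp add: submonoid.intro monoid.m_closed monoid.one_closed)
  from right_nat_action_selfmaps[OF stone_space_cantor_cube metrizable_space_cantor_cube this]
  have "right_nat_action (?M\<lparr>carrier := carrier ?M\<rparr>)
      (subtopology (compact_open_topology cantor_cube) (topspace (compact_open_topology cantor_cube)))
      (\<lambda>s. index_code (clopens cantor_cube) (preimage_on cantor_cube s))"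
    by (simp add: selfmap_monoid_def)
  moreover have "?M\<lparr>carrier := carrier ?M\<rparr> = ?M" by simp
  ultimately show thesis using that by (simp only: subtopology_topspace)
qed

theorem theorem5p10:
  shows
    "(polish_space (compact_open_topology cantor_cube) \<and>
      separable_space (compact_open_topology cantor_cube) \<and>
      metrizable_space (compact_open_topology cantor_cube) \<and>
      topological_monoid (selfmap_monoid cantor_cube) (compact_open_topology cantor_cube) \<and>
      l_NA (selfmap_monoid cantor_cube) (compact_open_topology cantor_cube))
   \<and> (\<forall>(M :: ('a, 'm) monoid_scheme) T.
        topological_monoid M T \<and> separable_space T \<and> metrizable_space T \<and> l_NA M T \<longrightarrow>
        (\<exists>h. topological_monoid_embedding M T
               (selfmap_monoid cantor_cube) (compact_open_topology cantor_cube) h))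
   \<and> (\<forall>(Y :: 'y topology) S.
        metrizable_space Y \<and> stone_space Y \<and> submonoid S (selfmap_monoid Y) \<longrightarrow>
        (\<exists>h \<alpha>.
           topological_monoid_embedding
             ((selfmap_monoid Y)\<lparr>carrier := S\<rparr>) (subtopology (compact_open_topology Y) S)
             (selfmap_monoid cantor_cube) (compact_open_topology cantor_cube) h \<and>
           embedding_map Y cantor_cube \<alpha> \<and>
           (\<forall>s\<in>S. \<forall>y\<in>topspace Y. \<alpha> (s y) = h s (\<alpha> y))))"
proof (intro conjI allI impI)
  let ?C = "compact_open_topology cantor_cube" and ?M = "selfmap_monoid cantor_cube"
  have top: "topspace ?C = carrier ?M" by (simp add: selfmap_monoid_def)
  \<comment> \<open>One right action on \<nat>, by preimages of clopen sets, yields metrizability,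
    the topological monoid structure and the l-NA witness.\<close>
  obtain \<rho> where \<rho>: "right_nat_action ?M ?C \<rho>" by (rule right_nat_action_cantor_selfmaps)
  show "polish_space ?C" by (rule polish_space_cantor_selfmaps)
  then show "separable_space ?C" by (simp add: polish_space_def)
  show "metrizable_space ?C" using \<rho> by (rule right_nat_action_imp_metrizable_space)
  show "topological_monoid ?M ?C"
    using monoid_selfmap_monoid top \<rho> by (rule right_nat_action_imp_topological_monoid)
  show "l_NA ?M ?C" using monoid_selfmap_monoid top \<rho> by (rule right_nat_action_imp_l_NA)
next
  fix M :: "('a, 'm) monoid_scheme" and T
  assume A: "topological_monoid M T \<and> separable_space T \<and> metrizable_space T \<and> l_NA M T"
  then obtain Z :: "'a set set topology" and act \<nu> where "l_NA_witness M T Z act \<nu>"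
    unfolding l_NA_def by blast
  with A obtain \<rho> where "right_nat_action M T \<rho>"
    using l_NA_witness_imp_right_nat_action by metis
  moreover have "topspace T = carrier M" using A by (simp add: topological_monoid_def)
  ultimately show "\<exists>h. topological_monoid_embedding M T
      (selfmap_monoid cantor_cube) (compact_open_topology cantor_cube) h"
    using right_nat_action_imp_embedding by blast
next
  fix Y :: "'y topology" and S
  assume A: "metrizable_space Y \<and> stone_space Y \<and> submonoid S (selfmap_monoid Y)"
  then have Y: "stone_space Y" and m: "metrizable_space Y" and S: "submonoid S (selfmap_monoid Y)"
    by blast+
  have SC: "S \<subseteq> cont_selfmaps Y" using submonoid.subset[OF S] by (simp add: selfmap_monoid_def)
  then have "topspace (subtopology (compact_open_topology Y) S) = carrier ((selfmap_monoid Y)\<lparr>carrier := S\<rparr>)"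
    by auto
  \<comment> \<open>This embedding reindexes by the coded preimage action on
    \<open>clopens Y\<close>. Since \<open>\<alpha>\<close> is built from the same coding, the two
    maps are compatible.\<close>
  note h = right_nat_action_imp_embedding[OF this right_nat_action_selfmaps[OF Y m S]]
  show "\<exists>h \<alpha>. topological_monoid_embedding
      ((selfmap_monoid Y)\<lparr>carrier := S\<rparr>) (subtopology (compact_open_topology Y) S)
      (selfmap_monoid cantor_cube) (compact_open_topology cantor_cube) h \<and>
      embedding_map Y cantor_cube \<alpha> \<and> (\<forall>s\<in>S. \<forall>y\<in>topspace Y. \<alpha> (s y) = h s (\<alpha> y))"
  proof (intro exI conjI ballI)
    show "embedding_map Y cantor_cube
      (\<lambda>y n. n \<in> to_nat_on (clopens Y) ` clopens Y \<and> y \<in> from_nat_into (clopens Y) n)"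
      by (rule metrizable_stone_space_embedding(1)[OF Y m])
    fix s y assume "s \<in> S" "y \<in> topspace Y"
    then show "(\<lambda>n. n \<in> to_nat_on (clopens Y) ` clopens Y \<and> s y \<in> from_nat_into (clopens Y) n) =
      (\<lambda>n. n \<in> to_nat_on (clopens Y) ` clopens Y \<and> y \<in> from_nat_into (clopens Y) n) \<circ>
        index_code (clopens Y) (preimage_on Y s)"
      using SC by (intro metrizable_stone_space_embedding(2)[OF Y m]) (auto simp: cont_selfmaps_def)
  qed (rule h)
qed

end
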